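(* Let $X$ be a $\delta$-dense multi-set of size $n$ that has no $\alpha$-almost divisor, where $\delta = 1699200\log(2n)\log^2(2\mu_X)$ and $\alpha = 42480\log(2\mu_X)$. There exists a partitioning $X = R\cup A\cup G$ (i.e. $\mu(x;X)=\mu(x;R)+\mu(x;A)+\mu(x;G)$ for all $x$) and an integer $s \le 42480\cdot\mu_X\,\Sigma(X)\log(2\mu_X)/n^2$ such that (i) $\mathcal{S}(R)$ is $s$-complete, that is, $\mathcal{S}(R)\bmod s = \mathbb{Z}_s$; (ii) $\mathcal{S}(A)$ contains an arithmetic progression $\mathcal{P}$ of length $2\max(X)$ and step size $s$ satisfying $\max(\mathcal{P}) \le 84960\,\mu_X\max(X)\,\Sigma(X)\log(2\mu_X)/n^2$; (iii) the multi-set $G$ has sum $\Sigma(G)\ge\Sigma(X)/2$.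
   Context: For a finite non-empty multi-set $X$ of positive integers: $|X|$ counts elements with multiplicity, $\mu(x;X)$ is the multiplicity of $x$ in $X$, $\max(X)$ is the maximum element, $\mu_X$ the largest multiplicity, $\Sigma(X)$ the sum of all elements, and $\mathcal{S}(X):=\{\Sigma(Y)\mid Y\subseteq X\}$. $X$ is $\delta$-dense if $|X|^2\ge\delta\cdot\mu_X\cdot\max(X)$. For an integer $d$, $X(d):=X\cap d\mathbb{Z}$ and $\overline{X(d)}:=X\setminus X(d)$; $d>1$ is an $\alpha$-almost divisor of $X$ if $|\overline{X(d)}|\le\alpha\mu_X\Sigma(X)/|X|^2$. An arithmetic progression of length $m$ and step size $s$ is a set $\{a+s,\dots,a+ms\}$. *)

theory Defs
  imports Complex_Main "HOL-Library.Multiset"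
begin

text \<open>
  Multisets of positive integers are multisets over \<^typ>\<open>int\<close> all of whose elements are positive.
  Size, sum and maximum are the library's \<^term>\<open>size X\<close>, \<^term>\<open>sum_mset X\<close> and \<^term>\<open>Max_mset X\<close>.
\<close>

definition pos_mset :: "int multiset \<Rightarrow> bool" where
  "pos_mset X \<longleftrightarrow> (\<forall>x\<in>#X. 0 < x)"

definition max_mult :: "int multiset \<Rightarrow> nat" where
  "max_mult X = Max (count X ` set_mset X)"

definition subset_sums :: "int multiset \<Rightarrow> int set" where
  "subset_sums X = {sum_mset Y |Y. Y \<subseteq># X}"

definition delta_dense :: "real \<Rightarrow> int multiset \<Rightarrow> bool" where
  "delta_dense \<delta> X \<longleftrightarrow> (real (size X))\<^sup>2 \<ge> \<delta> * real (max_mult X) * real_of_int (Max_mset X)"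

definition divisible_part :: "int multiset \<Rightarrow> int \<Rightarrow> int multiset" where
  "divisible_part X d = {#x \<in># X. d dvd x#}"

definition nondivisible_part :: "int multiset \<Rightarrow> int \<Rightarrow> int multiset" where
  "nondivisible_part X d = X - divisible_part X d"

definition almost_divisor :: "real \<Rightarrow> int multiset \<Rightarrow> int \<Rightarrow> bool" where
  "almost_divisor \<alpha> X d \<longleftrightarrow> d > 1 \<and>
     real (size (nondivisible_part X d))
       \<le> \<alpha> * real (max_mult X) * real_of_int (sum_mset X) / (real (size X))\<^sup>2"

text \<open>
  For \<^term>\<open>s > 0\<close> the residue ring modulo \<^term>\<open>s\<close> is represented by the canonical
  representatives \<open>{0..<s}\<close>.
\<close>

definition complete_mod :: "int \<Rightarrow> int set \<Rightarrow> bool" where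
  "complete_mod s S \<longleftrightarrow> (\<lambda>x. x mod s) ` S = {0..<s}"

text \<open>The offset \<^term>\<open>a\<close> is not itself a member of the progression and may be negative.\<close>

definition is_arith_prog :: "int set \<Rightarrow> int \<Rightarrow> int \<Rightarrow> bool" where
  "is_arith_prog P m s \<longleftrightarrow> (\<exists>a. P = {a + i * s |i. i \<in> {1..m}})"

end

theory Submission imports Defs "HOL-Computational_Algebra.Primes" begin

text \<open>
  Write \<open>\<Lambda> = \<mu> \<Sigma>(X) log(2\<mu>) / n\<^sup>2\<close>. For \<open>R\<close>, take about \<open>128 \<Lambda>\<close> arbitrary elements and,
  for each of the few primes \<open>p\<close> dividing more than half of them, as many as \<open>64 \<Lambda>\<close> further
  elements not divisible by \<open>p\<close>. Then \<open>R\<close> is complete modulo every \<open>s \<le> 64 \<Lambda>\<close>, because the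
  subset sums modulo \<open>s\<close> grow until they are stabilised by all remaining elements.

  For \<open>A\<close>, take \<open>n/8\<close> elements of the rest that are at most twice the average, and pigeonhole to
  a set \<open>Y\<close> of \<open>k\<close> values of multiplicity at least \<open>r\<close> with \<open>r k \<ge> n / (8 log(2\<mu>))\<close>. A second
  pigeonhole yields a set \<open>Z\<close> of at least \<open>k/2\<close> integers, each having many representations as a
  sum of two elements of \<open>Y\<close>, so that all sums of boundedly many elements of \<open>Z\<close> are subset sums
  of \<open>A\<close>. Let \<open>L = max Z\<close> and \<open>g = gcd Z\<close>. By the isoperimetric bound
  \<open>|S + T| \<ge> |S| + |T|/2\<close> for generating sets \<open>T\<close>, sums of \<open>O(L / (g |Z|))\<close> elements of \<open>Z\<close> cover
  all multiples of \<open>g\<close> modulo \<open>L\<close>, and adding copies of \<open>L\<close> itself turns this into a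
  progression of step \<open>g \<le> L / |Z|\<close>.
\<close>

section \<open>Subgroups of the integers\<close>

text \<open>The generator is the least positive member of \<open>H\<close>: a nonzero remainder
  modulo it would be a smaller one. This serves both for the group generated by a set of summands
  and for the stabiliser of a set of residues.\<close>

lemma int_subgroup_principal:
  fixes H :: "int set"
  assumes L: "L \<in> H" "L > 0" and diff: "\<And>x y. x \<in> H \<Longrightarrow> y \<in> H \<Longrightarrow> x - y \<in> H"
  shows "\<exists>g>0. H = {x. g dvd x}"
proof -
  have z: "0 \<in> H" using diff[OF L(1) L(1)] by simp
  have neg: "- x \<in> H" if "x \<in> H" for x using diff[OF z that] by simp
  have add: "x + y \<in> H" if "x \<in> H" "y \<in> H" for x y
    using diff[OF that(1) neg[OF that(2)]] by simp
  have nmul: "int k * x \<in> H" if "x \<in> H" for k x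
    by (induction k) (auto simp: z algebra_simps intro: add that)
  have mul: "c * x \<in> H" if "x \<in> H" for c x
    using nmul[OF that, of "nat c"] neg[OF nmul[OF that, of "nat (-c)"]] by (cases "c \<ge> 0") auto
  define P where "P k \<longleftrightarrow> k > 0 \<and> int k \<in> H" for k
  define g where "g = (LEAST k. P k)"
  have "P (nat L)" using L by (simp add: P_def)
  then have Pg: "P g" unfolding g_def by (rule LeastI)
  have least: "g \<le> k" if "P k" for k unfolding g_def using that by (rule Least_le)
  have "int g dvd x" if "x \<in> H" for x
  proof (rule ccontr)
    assume nd: "\<not> int g dvd x"
    have eq: "x mod int g = x - (x div int g) * int g"
      by (simp add: minus_div_mult_eq_mod)
    have "x mod int g \<in> H"
      unfolding eq using Pg that by (intro diff mul) (auto simp: P_def)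
    moreover have "x mod int g > 0"
      using nd Pg by (metis P_def dvd_eq_mod_eq_0 of_nat_0_less_iff order_less_le pos_mod_sign)
    ultimately have "P (nat (x mod int g))" by (simp add: P_def)
    from least[OF this] have "int g \<le> x mod int g" using \<open>x mod int g > 0\<close> by linarith
    moreover have "x mod int g < int g" using Pg by (intro pos_mod_bound) (simp add: P_def)
    ultimately show False by simp
  qed
  moreover have "x \<in> H" if "int g dvd x" for x
    using that mul[of "int g"] Pg by (auto simp: P_def dvd_def mult.commute)
  ultimately show ?thesis using Pg by (intro exI[of _ "int g"]) (auto simp: P_def)
qed

section \<open>Growth of sumsets modulo an integer\<close>

text \<open>Subsets of the finite group \<open>I / L\<int>\<close> are represented by their preimages, the
  \<open>L\<close>-periodic subsets of \<open>I\<close>; \<open>rcard\<close> counts residues.\<close>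

locale periodic_growth =
  fixes L :: int and I A :: "int set"
  assumes L_pos: "L > 0" and L_in: "L \<in> I"
    and I_diff: "\<And>x y. x \<in> I \<Longrightarrow> y \<in> I \<Longrightarrow> x - y \<in> I"
    and A_sub: "A \<subseteq> I" and zero_A: "0 \<in> A"
begin

definition per :: "int set \<Rightarrow> bool" where
  "per P \<longleftrightarrow> P \<subseteq> I \<and> (\<forall>x\<in>P. \<forall>k. x + k * L \<in> P)"

definition rcard :: "int set \<Rightarrow> nat" where
  "rcard P = card (P \<inter> {0..<L})"

definition expand :: "int set \<Rightarrow> int set" where
  "expand P = (\<Union>a\<in>A. (\<lambda>x. x + a) ` P)"

lemma I_add: "x \<in> I \<Longrightarrow> y \<in> I \<Longrightarrow> x + y \<in> I"
  using I_diff[of x "L - L - y"] I_diff[OF L_in L_in] I_diff[of 0 y] by simp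

lemma I_zero: "0 \<in> I" using A_sub zero_A by auto

lemma I_neg: "x \<in> I \<Longrightarrow> - x \<in> I"
  using I_diff[OF I_zero] by simp

lemma I_multiple: "k * L \<in> I"
proof -
  have n: "int j * L \<in> I" for j
    by (induction j) (auto simp: I_zero algebra_simps intro: I_add L_in)
  show ?thesis
    using n[of "nat k"] I_neg[OF n[of "nat (-k)"]] by (cases "k \<ge> 0") auto
qed

lemma per_I: "per I"
  using I_add I_multiple by (auto simp: per_def)

lemma per_subset: "per P \<Longrightarrow> P \<subseteq> I" by (simp add: per_def)

lemma per_mod:
  assumes "per P" shows "x mod L \<in> P \<longleftrightarrow> x \<in> P"
proof
  assume P: "x mod L \<in> P"
  then have "x mod L + (x div L) * L \<in> P" using assms unfolding per_def by blast
  then show "x \<in> P" by (simp add: add.commute)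
next
  assume P: "x \<in> P"
  then have "x + (- (x div L)) * L \<in> P" using assms unfolding per_def by blast
  then show "x mod L \<in> P" by (simp add: minus_div_mult_eq_mod)
qed

lemma per_Un: "per P \<Longrightarrow> per Q \<Longrightarrow> per (P \<union> Q)"
  and per_Int: "per P \<Longrightarrow> per Q \<Longrightarrow> per (P \<inter> Q)"
  unfolding per_def by blast+

lemma per_Diff:
  assumes "per P" "per Q" shows "per (P - Q)"
  unfolding per_def
proof (intro conjI ballI allI)
  show "P - Q \<subseteq> I" using per_subset[OF assms(1)] by auto
  fix x k assume x: "x \<in> P - Q"
  have "x + k * L \<notin> Q"
  proof
    assume "x + k * L \<in> Q"
    then have "x + k * L + (- k) * L \<in> Q" using assms(2) unfolding per_def by blast
    then show False using x by simp
  qed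
  then show "x + k * L \<in> P - Q" using x assms(1) unfolding per_def by blast
qed

lemma per_uminus:
  assumes "per P" shows "per (uminus ` P)"
  unfolding per_def
proof (intro conjI ballI allI)
  show "uminus ` P \<subseteq> I" using per_subset[OF assms] I_neg by auto
  fix x k assume "x \<in> uminus ` P"
  then obtain y where "y \<in> P" "x = - y" by auto
  then have "y + (- k) * L \<in> P" using assms unfolding per_def by blast
  then show "x + k * L \<in> uminus ` P" using \<open>x = - y\<close>
    by (intro image_eqI[of _ _ "y + (- k) * L"]) auto
qed

lemma per_shift:
  assumes "per P" "c \<in> I" shows "per ((\<lambda>x. x + c) ` P)"
  unfolding per_def
proof (intro conjI ballI allI)
  show "(\<lambda>x. x + c) ` P \<subseteq> I" using per_subset[OF assms(1)] assms(2) I_add by auto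
  fix x k assume "x \<in> (\<lambda>x. x + c) ` P"
  then obtain y where "y \<in> P" "x = y + c" by auto
  then have "y + k * L \<in> P" using assms unfolding per_def by blast
  then show "x + k * L \<in> (\<lambda>x. x + c) ` P" using \<open>x = y + c\<close>
    by (intro image_eqI[of _ _ "y + k * L"]) auto
qed

lemma per_expand:
  assumes "per P" shows "per (expand P)"
  unfolding per_def
proof (intro conjI ballI allI)
  show "expand P \<subseteq> I"
    using per_subset[OF assms] A_sub I_add unfolding expand_def by blast
  fix x k assume "x \<in> expand P"
  then obtain a y where ay: "a \<in> A" "y \<in> P" "x = y + a" by (auto simp: expand_def)
  then have "y + k * L \<in> P" using assms unfolding per_def by blast
  then have "(y + k * L) + a \<in> expand P" using ay(1) unfolding expand_def by blast
  then show "x + k * L \<in> expand P" using ay(3) by (simp add: add_ac)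
qed

lemma expand_superset: "P \<subseteq> expand P"
  unfolding expand_def using UN_upper[OF zero_A, of "\<lambda>a. (\<lambda>x. x + a) ` P"] by simp

lemma expand_mono: "P \<subseteq> Q \<Longrightarrow> expand P \<subseteq> expand Q"
  by (auto simp: expand_def)

lemma expand_shift: "expand ((\<lambda>x. x + c) ` P) = (\<lambda>x. x + c) ` expand P"
proof -
  have "(\<lambda>x. x + a) ` (\<lambda>x. x + c) ` P = (\<lambda>x. x + c) ` (\<lambda>x. x + a) ` P" for a
    by (simp add: image_image add_ac)
  then show ?thesis by (simp add: expand_def image_UN)
qed

lemma rcard_mono: "P \<subseteq> Q \<Longrightarrow> rcard P \<le> rcard Q"
  unfolding rcard_def by (intro card_mono) auto

lemma rcard_Un_Int: "rcard (P \<union> Q) + rcard (P \<inter> Q) = rcard P + rcard Q"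
proof -
  have "(P \<union> Q) \<inter> {0..<L} = (P \<inter> {0..<L}) \<union> (Q \<inter> {0..<L})"
    "(P \<inter> Q) \<inter> {0..<L} = (P \<inter> {0..<L}) \<inter> (Q \<inter> {0..<L})" by auto
  then show ?thesis unfolding rcard_def
    using card_Un_Int[of "P \<inter> {0..<L}" "Q \<inter> {0..<L}"] by simp
qed

lemma rcard_Diff: "Q \<subseteq> P \<Longrightarrow> rcard (P - Q) + rcard Q = rcard P"
proof -
  assume "Q \<subseteq> P"
  then have "(P - Q) \<union> Q = P" "(P - Q) \<inter> Q = {}" by auto
  then show ?thesis using rcard_Un_Int[of "P - Q" Q] by (simp add: rcard_def)
qed

lemma rcard_pos:
  assumes "per P" "P \<noteq> {}" shows "rcard P > 0"
proof -
  obtain x where "x \<in> P" using assms by auto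
  then have "x mod L \<in> P \<inter> {0..<L}" using per_mod[OF assms(1)] L_pos by simp
  then show ?thesis unfolding rcard_def by (auto simp: card_gt_0_iff)
qed

lemma rcard_psubset:
  assumes "per P" "per Q" "P \<subset> Q" shows "rcard P < rcard Q"
proof -
  have "Q - P \<noteq> {}" using assms(3) by auto
  from rcard_pos[OF per_Diff[OF assms(2,1)] this] show ?thesis
    using rcard_Diff[of P Q] assms(3) by auto
qed

text \<open>A map that is injective modulo \<open>L\<close> transports residues injectively.
  Translations and negation have such maps in both directions, hence preserve
  \<open>rcard\<close>.\<close>

lemma rcard_inj_le:
  assumes "per Q" and "\<And>x. x \<in> P \<Longrightarrow> f x \<in> Q" and "\<And>x y. L dvd f x - f y \<Longrightarrow> L dvd x - y"
  shows "rcard P \<le> rcard Q"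
  unfolding rcard_def
proof (rule card_inj_on_le[where f = "\<lambda>x. f x mod L"])
  show "inj_on (\<lambda>x. f x mod L) (P \<inter> {0..<L})"
  proof (rule inj_onI)
    fix x y assume xy: "x \<in> P \<inter> {0..<L}" "y \<in> P \<inter> {0..<L}" "f x mod L = f y mod L"
    then have "L dvd x - y" using assms(3)[of x y] by (simp add: mod_eq_dvd_iff)
    then have "x mod L = y mod L" by (simp only: mod_eq_dvd_iff)
    then show "x = y" using xy(1,2) by auto
  qed
  show "(\<lambda>x. f x mod L) ` (P \<inter> {0..<L}) \<subseteq> Q \<inter> {0..<L}"
    using assms(2) per_mod[OF assms(1)] L_pos by auto
qed auto

lemma rcard_shift:
  assumes "per P" "c \<in> I" shows "rcard ((\<lambda>x. x + c) ` P) = rcard P"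
proof (rule antisym)
  show "rcard ((\<lambda>x. x + c) ` P) \<le> rcard P"
    by (rule rcard_inj_le[OF assms(1), where f = "\<lambda>x. x - c"]) auto
  show "rcard P \<le> rcard ((\<lambda>x. x + c) ` P)"
    by (rule rcard_inj_le[OF per_shift[OF assms], where f = "\<lambda>x. x + c"]) auto
qed

lemma rcard_uminus:
  assumes "per P" shows "rcard (uminus ` P) = rcard P"
proof (rule antisym)
  have *: "L dvd x - y" if "L dvd - x - - y" for x y
    using that dvd_diff_commute[of L x y] by simp
  show "rcard (uminus ` P) \<le> rcard P"
    by (rule rcard_inj_le[OF assms(1), where f = uminus]) (use * in auto)
  show "rcard P \<le> rcard (uminus ` P)"
    by (rule rcard_inj_le[OF per_uminus[OF assms], where f = uminus]) (use * in auto)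
qed

section \<open>Fragments, atoms and the isoperimetric bound\<close>

text \<open>Fragments as in Hamidoune's isoperimetric method, but without minimality of the
  boundary, which is imposed only when an atom is chosen.\<close>

definition frag :: "int set \<Rightarrow> bool" where
  "frag P \<longleftrightarrow> per P \<and> P \<noteq> {} \<and> expand P \<noteq> I"

text \<open>The number of residues of \<open>P + A\<close> outside \<open>P\<close>. The subtraction
  never truncates, because \<open>0 \<in> A\<close> gives
  \<open>P \<subseteq> expand P\<close>.\<close>

definition bdry :: "int set \<Rightarrow> nat" where
  "bdry P = rcard (expand P) - rcard P"

lemma rcard_expand: "rcard (expand P) = rcard P + bdry P"
  unfolding bdry_def using rcard_mono[OF expand_superset, of P] by simp

lemma frag_shift:
  assumes "frag P" "c \<in> I"
  shows "frag ((\<lambda>x. x + c) ` P)" "bdry ((\<lambda>x. x + c) ` P) = bdry P"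
proof -
  have pe: "per (expand P)" using assms by (simp add: frag_def per_expand)
  have "(\<lambda>x. x + c) ` expand P \<noteq> I"
  proof
    assume eq: "(\<lambda>x. x + c) ` expand P = I"
    have "x \<in> expand P" if "x \<in> I" for x
    proof -
      have "x + c \<in> (\<lambda>x. x + c) ` expand P" using eq I_add that assms by simp
      then show ?thesis by auto
    qed
    then show False using assms per_subset[OF pe] by (auto simp: frag_def)
  qed
  then show "frag ((\<lambda>x. x + c) ` P)"
    using assms by (auto simp: frag_def per_shift expand_shift)
  show "bdry ((\<lambda>x. x + c) ` P) = bdry P"
    using assms pe by (simp add: bdry_def expand_shift rcard_shift frag_def)
qed

text \<open>Adding a member of \<open>A\<close> cannot carry \<open>F'\<close> into
  \<open>- F\<close>, since \<open>- u + a = - f\<close> would put \<open>u = f + a\<close> into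
  \<open>expand F\<close>. So \<open>expand F'\<close> avoids \<open>- F\<close>, which bounds its
  boundary. The size identity later caps the size of an atom.\<close>

lemma frag_dual:
  assumes "frag F"
  defines "F' \<equiv> uminus ` (I - expand F)"
  shows "frag F'" "bdry F' \<le> bdry F" "rcard F' + rcard F + bdry F = rcard I"
proof -
  have pF: "per F" "F \<noteq> {}" "per (expand F)" using assms by (auto simp: frag_def per_expand)
  have pF': "per F'" unfolding F'_def using pF per_I by (intro per_uminus per_Diff)
  have ne: "F' \<noteq> {}" using assms per_subset[OF pF(3)] by (auto simp: frag_def F'_def)
  have "expand F' \<inter> uminus ` F = {}"
  proof (rule ccontr)
    assume "expand F' \<inter> uminus ` F \<noteq> {}"
    then obtain v where v: "v \<in> expand F'" "v \<in> uminus ` F" by auto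
    then obtain u a where u: "u \<in> I - expand F" "a \<in> A" "v = - u + a"
      by (auto simp: F'_def expand_def[of "uminus ` (I - expand F)"])
    obtain f where "f \<in> F" "v = - f" using v by auto
    with u have "u \<in> I - expand F" "a \<in> A" "f \<in> F" "- u + a = - f" by auto
    then have "u = f + a" by simp
    then have "u \<in> expand F" using \<open>a \<in> A\<close> \<open>f \<in> F\<close> by (auto simp: expand_def)
    then show False using \<open>u \<in> I - expand F\<close> by simp
  qed
  then have sub: "expand F' \<subseteq> I - uminus ` F"
    using per_subset[OF per_expand[OF pF']] by auto
  have FI: "uminus ` F \<subseteq> I" using per_subset[OF per_uminus[OF pF(1)]] .
  then have "expand F' \<noteq> I" using sub pF(2) by auto
  then show "frag F'" using pF' ne by (simp add: frag_def)
  have 1: "rcard F' + rcard (expand F) = rcard I"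
    unfolding F'_def using rcard_Diff[OF per_subset[OF pF(3)]] rcard_uminus[OF per_Diff[OF per_I pF(3)]]
    by simp
  then show "rcard F' + rcard F + bdry F = rcard I" by (simp add: rcard_expand)
  have 2: "rcard (expand F') + rcard F \<le> rcard I"
    using rcard_mono[OF sub] rcard_Diff[OF FI] rcard_uminus[OF pF(1)] by simp
  show "bdry F' \<le> bdry F" using 1 2 by (simp add: rcard_expand)
qed

text \<open>Expansion commutes with unions and sends an intersection into the intersection of the
  expansions; inclusion-exclusion does the rest.\<close>

lemma bdry_submodular:
  "bdry (P \<union> Q) + bdry (P \<inter> Q) \<le> bdry P + bdry Q"
proof -
  have "expand (P \<union> Q) = expand P \<union> expand Q" by (auto simp: expand_def)
  moreover have "rcard (expand (P \<inter> Q)) \<le> rcard (expand P \<inter> expand Q)"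
    by (intro rcard_mono) (auto simp: expand_def)
  ultimately have "rcard (expand (P \<union> Q)) + rcard (expand (P \<inter> Q)) \<le> rcard (expand P) + rcard (expand Q)"
    using rcard_Un_Int[of "expand P" "expand Q"] by simp
  then show ?thesis using rcard_Un_Int[of P Q] by (simp add: rcard_expand)
qed

text \<open>An atom, that is, a fragment of least boundary and then of least size, is a subgroup up to
  translation (Hamidoune); the boundary of a proper subgroup is at least half of its expansion.\<close>

lemma rcard_expand_ge:
  assumes gen: "\<And>S. per S \<Longrightarrow> 0 \<in> S \<Longrightarrow> (\<And>x a. x \<in> S \<Longrightarrow> a \<in> A \<Longrightarrow> x + a \<in> S) \<Longrightarrow> S = I"
    and S: "frag S"
  shows "2 * rcard (expand S) \<ge> 2 * rcard S + rcard (expand (range (\<lambda>k. k * L)))"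
proof -
  \<comment> \<open>\<open>F0\<close> attains the least boundary, \<open>F1\<close> is smallest
    among the fragments with that boundary (an atom), and \<open>F\<close> is a translate of
    \<open>F1\<close> through 0.\<close>
  obtain F0 where F0: "frag F0" "\<And>P. frag P \<Longrightarrow> bdry F0 \<le> bdry P"
    using ex_has_least_nat[of frag S bdry] S by blast
  obtain F1 where F1: "frag F1" "bdry F1 = bdry F0"
    and F1min: "\<And>P. frag P \<Longrightarrow> bdry P = bdry F0 \<Longrightarrow> rcard F1 \<le> rcard P"
    using ex_has_least_nat[of "\<lambda>P. frag P \<and> bdry P = bdry F0" F0 rcard] F0 by blast
  obtain x0 where x0: "x0 \<in> F1" using F1 by (auto simp: frag_def)
  have x0I: "- x0 \<in> I" using x0 F1 I_neg per_subset by (auto simp: frag_def)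
  define F where "F = (\<lambda>x. x + - x0) ` F1"
  have F: "frag F" "bdry F = bdry F0"
    unfolding F_def using frag_shift[OF F1(1) x0I] F1(2) by auto
  have cF: "rcard F = rcard F1"
    unfolding F_def using rcard_shift[OF _ x0I] F1 by (auto simp: frag_def)
  have zF: "0 \<in> F" using x0 by (force simp: F_def)
  have pF: "per F" using F by (simp add: frag_def)
  have Fmin: "rcard F \<le> rcard P" if "frag P" "bdry P = bdry F0" for P
    using F1min[OF that] cF by simp
  \<comment> \<open>The dual of the atom is again a fragment of least boundary, hence at least as
    large as the atom.\<close>
  have big: "2 * rcard F + bdry F0 \<le> rcard I"
  proof -
    note d = frag_dual[OF F(1)]
    have "bdry (uminus ` (I - expand F)) = bdry F0" using d(2) F0(2)[OF d(1)] F(2) by simp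
    from Fmin[OF d(1) this] show ?thesis using d(3) F(2) by simp
  qed
  \<comment> \<open>Two different translates of the atom through 0 meet in a strictly smaller
    fragment, whose boundary must exceed the minimum. By submodularity their union has boundary
    below the minimum, so it is no fragment and expands to all of \<open>I\<close>; but then
    \<open>I\<close> would be smaller than \<open>big\<close> allows.\<close>
  have stable: "(\<lambda>y. y + - x) ` F = F" if x: "x \<in> F" for x
  proof (rule ccontr)
    assume neq: "(\<lambda>y. y + - x) ` F \<noteq> F"
    define F2 where "F2 = (\<lambda>y. y + - x) ` F"
    have xI: "- x \<in> I" using x pF I_neg per_subset by auto
    have F2: "frag F2" "bdry F2 = bdry F0" "rcard F2 = rcard F"
      unfolding F2_def using frag_shift[OF F(1) xI] F(2) rcard_shift[OF pF xI] by auto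
    have pF2: "per F2" using F2 by (simp add: frag_def)
    have z2: "0 \<in> F2" using x by (force simp: F2_def)
    have "\<not> F \<subseteq> F2"
    proof
      assume "F \<subseteq> F2"
      then have "F \<subset> F2" using neq by (auto simp: F2_def)
      then show False using rcard_psubset[OF pF pF2] F2 by simp
    qed
    then have ps: "F \<inter> F2 \<subset> F" by auto
    have pI: "per (F \<inter> F2)" using pF pF2 by (rule per_Int)
    have fi: "frag (F \<inter> F2)"
      using zF z2 pI F(1) expand_mono[of "F \<inter> F2" F] per_subset[OF per_expand[OF pF]]
      unfolding frag_def by blast
    have lt: "rcard (F \<inter> F2) < rcard F" using rcard_psubset[OF pI pF ps] .
    then have "bdry (F \<inter> F2) \<noteq> bdry F0" using Fmin[OF fi] by auto
    then have i1: "bdry (F \<inter> F2) \<ge> bdry F0 + 1" using F0(2)[OF fi] by simp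
    then have u1: "bdry (F \<union> F2) + 1 \<le> bdry F0"
      using bdry_submodular[of F F2] F(2) F2(2) by simp
    have "\<not> frag (F \<union> F2)" using F0(2)[of "F \<union> F2"] u1 by auto
    then have "expand (F \<union> F2) = I" using per_Un[OF pF pF2] zF by (auto simp: frag_def)
    then have "rcard I = rcard (F \<union> F2) + bdry (F \<union> F2)" using rcard_expand by metis
    moreover have "rcard (F \<union> F2) \<le> 2 * rcard F" using rcard_Un_Int[of F F2] F2(3) by simp
    ultimately show False using big u1 by simp
  qed
  have Fdiff: "y - x \<in> F" if "x \<in> F" "y \<in> F" for x y
    using stable[OF that(1)] that(2) by force
  have Fadd: "y + x \<in> F" if "x \<in> F" "y \<in> F" for x y
    using Fdiff[OF Fdiff[OF that(1) zF] that(2)] by simp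
  \<comment> \<open>\<open>F\<close> is now a subgroup. If it contained \<open>A\<close>, generation
    would force \<open>F = I\<close>, which is no fragment.\<close>
  obtain a where a: "a \<in> A" "a \<notin> F"
  proof (rule ccontr)
    assume "\<not> thesis"
    then have "A \<subseteq> F" using that by auto
    then have "F = I" using gen[OF pF zF] Fadd by blast
    then have "expand F = I"
      using expand_superset[of F] per_subset[OF per_expand[OF pF]] by auto
    then show False using F by (simp add: frag_def)
  qed
  have aI: "a \<in> I" using a A_sub by auto
  have disj: "F \<inter> (\<lambda>x. x + a) ` F = {}"
  proof (rule ccontr)
    assume "F \<inter> (\<lambda>x. x + a) ` F \<noteq> {}"
    then obtain f where "f \<in> F" "f + a \<in> F" by auto
    then show False using Fdiff[of f "f + a"] a by simp
  qed
  \<comment> \<open>Two disjoint cosets inside \<open>expand F\<close> make the boundary of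
    \<open>F\<close> at least half of \<open>expand F\<close>, which in turn contains all of
    \<open>A\<close> modulo \<open>L\<close>.\<close>
  have "F \<union> (\<lambda>x. x + a) ` F \<subseteq> expand F"
    using expand_superset[of F] a by (auto simp: expand_def)
  from rcard_mono[OF this] have two: "2 * rcard F \<le> rcard (expand F)"
    using rcard_Un_Int[of F "(\<lambda>x. x + a) ` F"] disj rcard_shift[OF pF aI] by (simp add: rcard_def)
  have "range (\<lambda>k. k * L) \<subseteq> F" using zF pF unfolding per_def by (metis add_0 image_subsetI)
  from rcard_mono[OF expand_mono[OF this]]
  have "rcard (expand (range (\<lambda>k. k * L))) \<le> rcard (expand F)" .
  then have "rcard (expand (range (\<lambda>k. k * L))) \<le> 2 * bdry F0"
    using two F(2) by (simp add: rcard_expand)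
  then show ?thesis using F0(2)[OF S] by (simp add: rcard_expand)
qed

end

section \<open>Bounded sums covering all residues\<close>

lemma sum_mset_repeat: "sum_mset (repeat_mset n W) = int n * sum_mset W"
  by (induction n) (simp_all add: algebra_simps)

lemma set_mset_repeat: "set_mset (repeat_mset n W) \<subseteq> set_mset W"
  by (induction n) auto

text \<open>The group \<open>I\<close> generated by \<open>Z\<close> consists of the multiples of
  some \<open>g\<close>, at most \<open>L / g\<close> classes modulo \<open>L\<close>. Each further
  summand gains at least \<open>card Z / 2\<close> classes until \<open>I\<close> is full, so
  \<open>h\<close> summands suffice once \<open>h * card Z\<close> reaches
  \<open>2 * L / g\<close>.\<close>

lemma sums_cover_residues:
  fixes Z :: "int set"
  assumes Z: "\<And>z. z \<in> Z \<Longrightarrow> 0 < z \<and> z \<le> L" and LZ: "L \<in> Z"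
  obtains g where "g > 0" and "\<And>z. z \<in> Z \<Longrightarrow> g dvd z" and "g * int (card Z) \<le> L"
    and "\<And>h v. 2 * L \<le> g * int (h * card Z) \<Longrightarrow> g dvd v \<Longrightarrow>
           \<exists>W. set_mset W \<subseteq> Z \<and> size W \<le> h \<and> L dvd v - sum_mset W"
proof -
  define S where "S h = {x. \<exists>W. set_mset W \<subseteq> Z \<and> size W \<le> h \<and> L dvd x - sum_mset W}" for h
  define I where "I = {x. \<exists>W. set_mset W \<subseteq> Z \<and> L dvd x - sum_mset W}"
  have Lpos: "L > 0" using Z[OF LZ] by simp
  have SI: "S h \<subseteq> I" for h by (auto simp: S_def I_def)
  have ZI: "z \<in> I" if "z \<in> Z" for z
    unfolding I_def using that by (intro CollectI exI[of _ "{#z#}"]) auto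
  have I0: "0 \<in> I" unfolding I_def by (intro CollectI exI[of _ "{#}"]) auto
  have Idiff: "x - y \<in> I" if "x \<in> I" "y \<in> I" for x y
  proof -
    obtain V W where V: "set_mset V \<subseteq> Z" "L dvd x - sum_mset V"
      and W: "set_mset W \<subseteq> Z" "L dvd y - sum_mset W" using \<open>x \<in> I\<close> \<open>y \<in> I\<close> by (auto simp: I_def)
    \<comment> \<open>Modulo \<open>L\<close>, \<open>L - 1\<close> copies of \<open>W\<close> stand
      in for \<open>- W\<close>.\<close>
    let ?U = "V + repeat_mset (nat (L - 1)) W"
    have sub: "set_mset ?U \<subseteq> Z" using V(1) W(1) set_mset_repeat by fastforce
    have eq: "x - y - sum_mset ?U = (x - sum_mset V) - (y - sum_mset W) - L * sum_mset W"
      using Lpos by (simp add: sum_mset_repeat algebra_simps)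
    have "L dvd x - y - sum_mset ?U" unfolding eq using V(2) W(2) by (metis dvd_diff dvd_triv_left)
    then show ?thesis unfolding I_def using sub by blast
  qed
  interpret periodic_growth L I "insert 0 Z"
  proof
    show "insert 0 Z \<subseteq> I" using ZI I0 by auto
  qed (use Lpos ZI[OF LZ] Idiff in simp_all)
  have perS: "per (S h)" for h
    unfolding per_def
  proof (intro conjI ballI allI)
    fix x k assume "x \<in> S h"
    then obtain W where W: "set_mset W \<subseteq> Z" "size W \<le> h" "L dvd x - sum_mset W"
      by (auto simp: S_def)
    have "L dvd (x - sum_mset W) + k * L" using W(3) by simp
    then have "L dvd x + k * L - sum_mset W" by (simp add: algebra_simps)
    then show "x + k * L \<in> S h" using W by (auto simp: S_def)
  qed (rule SI)
  have S0: "0 \<in> S h" for h unfolding S_def by (intro CollectI exI[of _ "{#}"]) auto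
  have expS: "expand (S h) \<subseteq> S (Suc h)" for h
  proof
    fix x assume "x \<in> expand (S h)"
    then obtain a y where ay: "a \<in> insert 0 Z" "y \<in> S h" "x = y + a"
      unfolding expand_def by blast
    obtain W where W: "set_mset W \<subseteq> Z" "size W \<le> h" "L dvd y - sum_mset W"
      using ay(2) by (auto simp: S_def)
    show "x \<in> S (Suc h)"
    proof (cases "a = 0")
      case True
      then show ?thesis using ay(3) W unfolding S_def by (intro CollectI exI[of _ W]) auto
    next
      case False
      then show ?thesis using ay W unfolding S_def
        by (intro CollectI exI[of _ "add_mset a W"]) auto
    qed
  qed
  have gen: "T = I" if T: "per T" "0 \<in> T" "\<And>x a. x \<in> T \<Longrightarrow> a \<in> insert 0 Z \<Longrightarrow> x + a \<in> T" for T
  proof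
    show "T \<subseteq> I" using per_subset[OF T(1)] .
    have sumT: "sum_mset W \<in> T" if "set_mset W \<subseteq> Z" for W
      using that
    proof (induction W)
      case (add z W)
      then show ?case using T(3)[of "sum_mset W" z] by (simp add: add.commute)
    qed (simp add: T(2))
    show "I \<subseteq> T"
    proof
      fix x assume "x \<in> I"
      then obtain W where W: "set_mset W \<subseteq> Z" "L dvd x - sum_mset W" by (auto simp: I_def)
      then obtain k where "x - sum_mset W = L * k" by (auto elim: dvdE)
      then have "x = sum_mset W + k * L" by (simp add: algebra_simps)
      moreover have "sum_mset W \<in> T" using sumT W(1) .
      ultimately show "x \<in> T" using T(1) unfolding per_def by blast
    qed
  qed
  \<comment> \<open>The multiples of \<open>L\<close> represent the zero class, so \<open>q\<close>
    counts the residues of \<open>insert 0 Z\<close>.\<close>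
  define q where "q = rcard (expand (range (\<lambda>k. k * L)))"
  have grow: "2 * rcard (S h) \<ge> h * q \<or> S h = I" for h
  proof (induction h)
    case (Suc h)
    show ?case
    proof (cases "expand (S h) = I")
      case True
      then show ?thesis using expS[of h] SI[of "Suc h"] by auto
    next
      case False
      then have "frag (S h)" using perS[of h] S0[of h] unfolding frag_def by blast
      then have "2 * rcard (expand (S h)) \<ge> 2 * rcard (S h) + q"
        unfolding q_def by (rule rcard_expand_ge[rotated]) (rule gen)
      moreover have "S h \<noteq> I" using False SI[of h] expand_superset[of "S h"]
          per_subset[OF per_expand[OF perS]] by auto
      ultimately show ?thesis using Suc rcard_mono[OF expS[of h]] by auto
    qed
  qed simp
  \<comment> \<open>Members of \<open>Z\<close> lie in \<open>{1..L}\<close> and are therefore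
    distinct modulo \<open>L\<close>; \<open>L\<close> itself takes the class 0.\<close>
  have "card Z \<le> card (expand (range (\<lambda>k. k * L)) \<inter> {0..<L})"
  proof (rule card_inj_on_le[where f = "\<lambda>z. z mod L"])
    show "inj_on (\<lambda>z. z mod L) Z"
    proof (rule inj_onI)
      fix x y assume xy: "x \<in> Z" "y \<in> Z" "x mod L = y mod L"
      then have "L dvd x - y" by (simp add: mod_eq_dvd_iff)
      moreover have "\<bar>x - y\<bar> < L" using Z[OF xy(1)] Z[OF xy(2)] by linarith
      ultimately show "x = y" using zdvd_imp_le[of L "\<bar>x - y\<bar>"] by fastforce
    qed
    show "(\<lambda>z. z mod L) ` Z \<subseteq> expand (range (\<lambda>k. k * L)) \<inter> {0..<L}"
    proof (rule image_subsetI)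
      fix z assume "z \<in> Z"
      have "z mod L = (- (z div L)) * L + z" by (simp add: minus_div_mult_eq_mod[symmetric])
      then have "z mod L \<in> expand (range (\<lambda>k. k * L))"
        unfolding expand_def using \<open>z \<in> Z\<close> by blast
      then show "z mod L \<in> expand (range (\<lambda>k. k * L)) \<inter> {0..<L}" using Lpos by simp
    qed
  qed simp
  then have Zq: "card Z \<le> q" by (simp add: q_def rcard_def)
  have "range (\<lambda>k. k * L) \<subseteq> S 0" unfolding S_def
    by (auto intro!: exI[of _ "{#}"])
  from expand_mono[OF this] have "q \<le> rcard I"
    unfolding q_def using expS[of 0] SI[of 1] by (intro rcard_mono) auto
  obtain g where g: "g > 0" "I = {x. g dvd x}"
    using int_subgroup_principal[OF ZI[OF LZ] Lpos Idiff] by blast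
  have "rcard I \<le> card {0..<L div g}"
    unfolding rcard_def
  proof (rule card_inj_on_le[where f = "\<lambda>x. x div g"])
    show "inj_on (\<lambda>x. x div g) (I \<inter> {0..<L})"
      unfolding g(2) by (rule inj_onI) (metis CollectD IntD1 dvd_div_mult_self)
    have gL: "g dvd L" using ZI[OF LZ] g by simp
    show "(\<lambda>x. x div g) ` (I \<inter> {0..<L}) \<subseteq> {0..<L div g}"
    proof (rule image_subsetI)
      fix x assume "x \<in> I \<inter> {0..<L}"
      then have x: "g dvd x" "0 \<le> x" "x < L" using g(2) by auto
      then have "x div g < L div g" using gL g(1) by (metis dvd_div_mult_self mult_less_cancel_right_pos)
      then show "x div g \<in> {0..<L div g}" using x(2) g(1) by (simp add: pos_imp_zdiv_nonneg_iff)
    qed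
  qed simp
  then have "int (rcard I) \<le> L div g"
    using pos_imp_zdiv_nonneg_iff[OF g(1), of L] Lpos by simp
  then have "g * int (rcard I) \<le> g * (L div g)" using g(1) by simp
  also have "\<dots> \<le> L" using ZI[OF LZ] g(2) by simp
  finally have gI: "g * int (rcard I) \<le> L" .
  show ?thesis
  proof (rule that[OF g(1)])
    show "g dvd z" if "z \<in> Z" for z using ZI[OF that] g by simp
    have "int (card Z) \<le> int (rcard I)" using Zq \<open>q \<le> rcard I\<close> by simp
    then have "g * int (card Z) \<le> g * int (rcard I)" using g by simp
    then show "g * int (card Z) \<le> L" using gI by simp
  next
    fix h v assume h: "2 * L \<le> g * int (h * card Z)" and v: "g dvd v"
    have "g * int (h * card Z) \<le> g * int (h * q)"
      using g(1) mult_le_mono2[OF Zq, of h] by (simp only: mult_le_cancel_left_pos of_nat_le_iff)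
    then have "g * int (2 * rcard I) \<le> g * int (h * q)" using h gI by simp
    then have "2 * rcard I \<le> h * q" using g(1) by (simp only: mult_le_cancel_left_pos of_nat_le_iff)
    have "S h = I"
    proof (rule ccontr)
      assume "S h \<noteq> I"
      then have "rcard (S h) < rcard I" using SI by (intro rcard_psubset perS per_I) auto
      then show False using grow[of h] \<open>S h \<noteq> I\<close> \<open>2 * rcard I \<le> h * q\<close> by simp
    qed
    then have "v \<in> S h" using v g by simp
    then show "\<exists>W. set_mset W \<subseteq> Z \<and> size W \<le> h \<and> L dvd v - sum_mset W" by (auto simp: S_def)
  qed
qed

section \<open>Arithmetic progressions among subset sums\<close>

lemma sum_count_le_size:
  assumes "finite T" shows "sum (count U) T \<le> size U"
proof -
  have "sum (count U) T \<le> sum (count U) (T \<union> set_mset U)"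
    using assms by (intro sum_mono2) auto
  also have "\<dots> = sum (count U) (set_mset U)"
    using assms by (intro sum.mono_neutral_right) (auto simp: not_in_iff)
  finally show ?thesis by (simp add: size_multiset_overloaded_eq)
qed

text \<open>Greedy choice: each \<open>z\<close> is replaced by a pair \<open>y\<close>,
  \<open>z - y\<close> not yet used up. If all pairs for \<open>z\<close> were blocked, the used
  part \<open>U\<close> would satisfy \<open>r * t \<le> 2 * size U + 1\<close>, which the bound on
  \<open>size W\<close> excludes.\<close>

lemma sums_of_popular_pairs:
  fixes Y Z :: "int set"
  assumes fin: "finite Y" and r: "\<And>y. y \<in> Y \<Longrightarrow> r \<le> count A y"
    and t: "\<And>z. z \<in> Z \<Longrightarrow> t \<le> card {y \<in> Y. z - y \<in> Y}"
    and W: "set_mset W \<subseteq> Z" "4 * size W \<le> r * t"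
  shows "\<exists>U. U \<subseteq># A \<and> sum_mset U = sum_mset W \<and> size U = 2 * size W"
  using W
proof (induction W)
  case empty
  then show ?case by (intro exI[of _ "{#}"]) auto
next
  case (add z W)
  then obtain U where U: "U \<subseteq># A" "sum_mset U = sum_mset W" "size U = 2 * size W" by auto
  define T where "T = {y \<in> Y. z - y \<in> Y}"
  have finT: "finite T" using fin by (simp add: T_def)
  have "\<exists>y\<in>T. {#y, z - y#} \<subseteq># A - U"
  proof (rule ccontr)
    assume neg: "\<not> ?thesis"
    \<comment> \<open>The extra 1 is for the pair with equal members, which needs two copies of
      \<open>y\<close>. It occurs for at most one \<open>y\<close>.\<close>
    have each: "r \<le> count U y + count U (z - y) + (if y + y = z then 1 else 0)" if y: "y \<in> T" for y
    proof (rule ccontr)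
      assume c: "\<not> ?thesis"
      have ry: "r \<le> count A y" "r \<le> count A (z - y)" using y r by (auto simp: T_def)
      have "{#y, z - y#} \<subseteq># A - U"
      proof (cases "y + y = z")
        case True
        then have "z - y = y" by simp
        then show ?thesis using c ry True by (auto simp: subseteq_mset_def)
      next
        case False
        then have "z - y \<noteq> y" by auto
        then show ?thesis using c ry False by (auto simp: subseteq_mset_def)
      qed
      then show False using neg y by blast
    qed
    have "r * t \<le> r * card T" using t[of z] add.prems by (simp add: T_def)
    also have "\<dots> = (\<Sum>y\<in>T. r)" by simp
    also have "\<dots> \<le> (\<Sum>y\<in>T. count U y + count U (z - y) + (if y + y = z then 1 else 0))"
      by (intro sum_mono each)
    also have "\<dots> = sum (count U) T + (\<Sum>y\<in>T. count U (z - y)) + card {y \<in> T. y + y = z}"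
      using finT by (simp add: sum.distrib sum.If_cases Int_def)
    also have "(\<Sum>y\<in>T. count U (z - y)) = sum (count U) ((\<lambda>y. z - y) ` T)"
      by (subst sum.reindex) (auto simp: inj_on_def)
    also have "sum (count U) T + sum (count U) ((\<lambda>y. z - y) ` T) + card {y \<in> T. y + y = z}
        \<le> size U + size U + 1"
    proof (intro add_mono sum_count_le_size)
      have "{y \<in> T. y + y = z} \<subseteq> {z div 2}" by auto
      from card_mono[OF _ this] show "card {y \<in> T. y + y = z} \<le> 1" by simp
    qed (use finT in auto)
    finally show False using add.prems U(3) by simp
  qed
  then obtain y where y: "y \<in> T" "{#y, z - y#} \<subseteq># A - U" by blast
  have "U + {#y, z - y#} \<subseteq># A"
    using y(2) U(1) by (metis subset_mset.add_diff_inverse subset_mset.add_left_mono)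
  then show ?case using U by (intro exI[of _ "U + {#y, z - y#}"]) auto
qed

text \<open>Induction with \<open>1 / (k + 1) \<le> ln ((k + 1) / k)\<close>, and \<open>ln\<close>
  is at most \<open>log 2\<close> above 1.\<close>

lemma harmonic_sum_le_log:
  assumes "k \<ge> 1" shows "(\<Sum>i=1..k. 1 / real i) \<le> log 2 (2 * real k)"
  using assms
proof (induction k rule: nat_induct_at_least)
  case base
  then show ?case by simp
next
  case (Suc k)
  have k: "real k > 0" using Suc by simp
  define x where "x = real (Suc k) / real k"
  have x: "x > 1" using k by (simp add: x_def)
  have "ln (1 / x) \<le> 1 / x - 1" using x by (intro ln_le_minus_one) simp
  then have "1 - 1 / x \<le> ln x" using x by (simp add: ln_div)
  also have "ln x \<le> ln x / ln 2" using x ln_le_minus_one[of 2]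
    by (simp add: divide_simps)
  also have "\<dots> = log 2 x" by (simp add: log_def)
  finally have "1 / real (Suc k) \<le> log 2 x" using k by (simp add: x_def field_simps)
  moreover have "log 2 (2 * real (Suc k)) = log 2 (2 * real k) + log 2 x"
    using k by (subst log_mult_pos[symmetric]) (auto simp: x_def)
  ultimately show ?case using Suc by simp
qed

text \<open>The sum of \<open>f\<close> is the sum of its level set sizes over \<open>t\<close>. If
  no level worked, each size would be below \<open>c + K / t\<close>, and the harmonic bound
  contradicts \<open>total\<close>. The parameter \<open>c\<close> additionally forces the level set
  to be large. It is applied to multiplicities with \<open>c = 0\<close> and to numbers of
  representations with a positive \<open>c\<close>.\<close>

lemma popular_level:
  fixes f :: "'a \<Rightarrow> nat" and c K :: real
  assumes fin: "finite S" and f: "\<And>x. x \<in> S \<Longrightarrow> f x \<le> k" and k: "k \<ge> 1" and c: "c \<ge> 0" and K: "K > 0"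
    and total: "c * real k + K * log 2 (2 * real k) \<le> real (sum f S)"
  obtains t where "1 \<le> t" "t \<le> k" "c \<le> real (card {x \<in> S. t \<le> f x})"
    "K \<le> real t * real (card {x \<in> S. t \<le> f x})"
proof (rule ccontr)
  assume nt: "\<not> thesis"
  note thesisI = that
  let ?N = "\<lambda>t. card {x \<in> S. t \<le> f x}"
  have lt: "real (?N t) < c + K * (1 / real t)" if t: "t \<in> {1..k}" for t
  proof (cases "c \<le> real (?N t)")
    case True
    then have "real t * real (?N t) < K" using nt thesisI[of t] t by force
    then have "real (?N t) < K / real t" using t by (simp add: field_simps)
    then show ?thesis using c by simp
  next
    case False
    have "K * (1 / real t) > 0" using t K by simp
    then show ?thesis using False by linarith
  qed
  have "sum f S = (\<Sum>x\<in>S. \<Sum>t=1..k. if t \<le> f x then 1 else 0)"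
  proof (intro sum.cong refl)
    fix x assume "x \<in> S"
    have "{1..k} \<inter> {t. t \<le> f x} = {1..f x}" using f[OF \<open>x \<in> S\<close>] by auto
    then show "f x = (\<Sum>t=1..k. if t \<le> f x then 1 else 0)" by (simp add: sum.If_cases)
  qed
  also have "\<dots> = (\<Sum>t=1..k. \<Sum>x\<in>S. if t \<le> f x then 1 else 0)" by (rule sum.swap)
  also have "\<dots> = (\<Sum>t=1..k. ?N t)" using fin by (simp add: sum.If_cases Int_def)
  finally have "real (sum f S) = (\<Sum>t=1..k. real (?N t))" by simp
  also have "\<dots> < (\<Sum>t=1..k. c + K * (1 / real t))" using k by (intro sum_strict_mono lt) auto
  also have "\<dots> = c * real k + K * (\<Sum>t=1..k. 1 / real t)"
    by (simp add: sum.distrib sum_distrib_left mult.commute)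
  also have "\<dots> \<le> c * real k + K * log 2 (2 * real k)"
    using harmonic_sum_le_log[OF k] K by (intro add_left_mono mult_left_mono) auto
  finally show False using total by simp
qed

lemma sum_mset_bounds:
  fixes W :: "int multiset" and c :: real
  shows "(\<And>x. x \<in># W \<Longrightarrow> real_of_int x \<le> c) \<Longrightarrow> real_of_int (sum_mset W) \<le> real (size W) * c"
    and "(\<And>x. x \<in># W \<Longrightarrow> c \<le> real_of_int x) \<Longrightarrow> real (size W) * c \<le> real_of_int (sum_mset W)"
  by (induction W; force simp: algebra_simps)+

text \<open>Popular sums of two elements of \<open>Y\<close> form \<open>Z\<close>, and sums of
  boundedly many elements of \<open>Z\<close> are realised in \<open>A\<close>. Such sums reach
  every multiple of \<open>g\<close> modulo \<open>L = Max Z\<close>; copies of \<open>L\<close>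
  then correct the value exactly, giving a progression of step \<open>g\<close>.\<close>

lemma arith_prog_in_subset_sums:
  fixes Y :: "int set" and m :: int and l :: real
  assumes fin: "finite Y" and ne: "Y \<noteq> {}"
    and Y: "\<And>y. y \<in> Y \<Longrightarrow> 0 < y \<and> y \<le> m \<and> real_of_int y \<le> l \<and> r \<le> count A y"
    and dense: "128 * real_of_int m * log 2 (2 * real (card Y)) \<le> real r * (real (card Y))\<^sup>2"
  obtains s P where "0 < s" "real_of_int s \<le> 4 * l / real (card Y)" "is_arith_prog P (2 * m) s"
    "P \<subseteq> subset_sums A" "real_of_int (Max P) \<le> 32 * l * real_of_int m / real (card Y)"
proof -
  define k where "k = card Y"
  define f where "f z = card {y \<in> Y. z - y \<in> Y}" for z
  define S where "S = {2..2 * m}"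
  define lg where "lg = log 2 (2 * real k)"
  have k: "k \<ge> 1" using fin ne by (simp add: k_def Suc_le_eq card_gt_0_iff)
  have lg: "lg \<ge> 1" using k by (simp add: lg_def le_log_iff)
  obtain y0 where "y0 \<in> Y" using ne by auto
  then have m: "m \<ge> 1" using Y by force
  \<comment> \<open>Double counting of ordered pairs from \<open>Y\<close>: all their sums lie in
    \<open>S\<close>.\<close>
  have "sum f S = (\<Sum>z\<in>S. \<Sum>y\<in>Y. if z - y \<in> Y then 1 else 0)"
    using fin by (simp add: f_def sum.If_cases Int_def)
  also have "\<dots> = (\<Sum>y\<in>Y. \<Sum>z\<in>S. if z - y \<in> Y then 1 else 0)" by (rule sum.swap)
  also have "\<dots> = (\<Sum>y\<in>Y. k)"
  proof (intro sum.cong refl)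
    fix y assume "y \<in> Y"
    have "S \<inter> {z. z - y \<in> Y} = (\<lambda>x. x + y) ` Y"
    proof (rule set_eqI)
      fix z
      have "z \<in> S" if "z - y \<in> Y" using Y[OF that] Y[OF \<open>y \<in> Y\<close>] by (simp add: S_def)
      then show "z \<in> S \<inter> {z. z - y \<in> Y} \<longleftrightarrow> z \<in> (\<lambda>x. x + y) ` Y" by force
    qed
    moreover have "card ((\<lambda>x. x + y) ` Y) = k" unfolding k_def by (intro card_image) (auto simp: inj_on_def)
    ultimately show "(\<Sum>z\<in>S. if z - y \<in> Y then 1 else 0) = k"
      by (simp add: sum.If_cases S_def)
  qed
  finally have total: "real (sum f S) = (real k)\<^sup>2" by (simp add: k_def power2_eq_square)
  have fk: "f z \<le> k" for z unfolding f_def k_def using fin by (intro card_mono) auto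
  \<comment> \<open>Half of the \<open>k * k\<close> pairs pays for
    \<open>card Z \<ge> k / 2\<close>, the other half for this \<open>K\<close>.\<close>
  define K where "K = (real k)\<^sup>2 / (2 * lg)"
  obtain t where t: "1 \<le> t" "t \<le> k" "real k / 2 \<le> real (card {z \<in> S. t \<le> f z})"
    "K \<le> real t * real (card {z \<in> S. t \<le> f z})"
  proof (rule popular_level[of S f k "real k / 2" K])
    show "K > 0" using k lg by (simp add: K_def)
    show "real k / 2 * real k + K * log 2 (2 * real k) \<le> real (sum f S)"
      unfolding total lg_def[symmetric] K_def using lg by (simp add: power2_eq_square)
  qed (use fk k in \<open>auto simp: S_def\<close>)
  define Z where "Z = {z \<in> S. t \<le> f z}"
  define q where "q = card Z"
  have finZ: "finite Z" unfolding Z_def S_def by (rule finite_subset[of _ "{2..2 * m}"]) auto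
  have q2: "real k \<le> 2 * real q" and tq: "K \<le> real t * real q" using t by (auto simp: q_def Z_def)
  have q: "q \<ge> 1" using q2 k by linarith
  then have Zne: "Z \<noteq> {}" by (auto simp: q_def)
  define L where "L = Max Z"
  have LZ: "L \<in> Z" using finZ Zne by (simp add: L_def)
  have ZL: "0 < z \<and> z \<le> L" if "z \<in> Z" for z
    using that finZ by (auto simp: L_def Z_def S_def)
  have Lpos: "L > 0" using ZL[OF LZ] by simp
  have L2m: "L \<le> 2 * m" using LZ by (simp add: Z_def S_def)
  \<comment> \<open>\<open>L\<close> is a sum of two members of \<open>Y\<close>, so it is at most
    \<open>2 * l\<close> as well as \<open>2 * m\<close>. The bound by \<open>l\<close> keeps the
    step small.\<close>
  have "f L > 0" using LZ t(1) by (simp add: Z_def)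
  then obtain y where "y \<in> Y" "L - y \<in> Y" by (auto simp: f_def card_gt_0_iff)
  then have L2l: "real_of_int L \<le> 2 * l" using Y[of y] Y[of "L - y"] by simp
  obtain g where g: "g > 0" and gZ: "\<And>z. z \<in> Z \<Longrightarrow> g dvd z" and gq: "g * int q \<le> L"
    and cover: "\<And>h v. 2 * L \<le> g * int (h * q) \<Longrightarrow> g dvd v \<Longrightarrow>
           \<exists>W. set_mset W \<subseteq> Z \<and> size W \<le> h \<and> L dvd v - sum_mset W"
    using sums_cover_residues[OF ZL LZ] unfolding q_def by metis
  define G Q Lr mr where "G = real_of_int g" and "Q = real q" and "Lr = real_of_int L"
    and "mr = real_of_int m"
  have G1: "G \<ge> 1" using g by (simp add: G_def)
  have Q1: "Q \<ge> 1" using q by (simp add: Q_def)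
  have L0: "Lr > 0" using Lpos by (simp add: Lr_def)
  have m1: "mr \<ge> 1" using m by (simp add: mr_def)
  have GQ: "G * Q \<le> Lr" using gq unfolding G_def Q_def Lr_def
    by (metis of_int_le_iff of_int_mult of_int_of_nat_eq)
  have Lm: "Lr \<le> 2 * mr" using L2m unfolding Lr_def mr_def by linarith
  have Ll: "Lr \<le> 2 * l" using L2l by (simp add: Lr_def)
  define u where "u = Lr / (G * Q)"
  have u1: "u \<ge> 1" using GQ G1 Q1 by (simp add: u_def)
  have "u \<le> Lr / Q" unfolding u_def using G1 Q1 L0 by (intro divide_left_mono) auto
  also have "\<dots> \<le> 2 * mr / Q" using Lm Q1 by (intro divide_right_mono) auto
  finally have u2: "u \<le> 2 * (mr / Q)" by simp
  have GL: "G \<le> Lr / Q" using GQ Q1 by (simp add: field_simps)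
  also have "\<dots> \<le> 2 * l / Q" using Ll Q1 by (intro divide_right_mono) auto
  finally have Gl: "G \<le> 2 * (l / Q)" by simp
  \<comment> \<open>\<open>h\<close> summands reach every residue, and \<open>e\<close> copies of
    \<open>L\<close> span the length \<open>2 * m * g\<close> of the progression. In total
    \<open>2 * h + e\<close> elements of \<open>Z\<close> are needed: \<open>h\<close> for the
    residue and up to \<open>h + e\<close> copies of \<open>L\<close>.\<close>
  define h where "h = nat \<lceil>2 * u\<rceil>"
  define e where "e = nat \<lceil>2 * mr * G / Lr\<rceil>"
  have h: "2 * u \<le> real h" "real h \<le> 2 * u + 1" using u1 unfolding h_def by linarith+
  have "2 * mr * G / Lr \<ge> 0" using m1 G1 L0 by simp
  then have e: "2 * mr * G / Lr \<le> real e" "real e \<le> 2 * mr * G / Lr + 1" unfolding e_def by linarith+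
  have "mr * (G / Lr) \<le> mr * (1 / Q)" using GQ Q1 L0 m1 by (intro mult_left_mono) (auto simp: field_simps)
  then have "real e \<le> 2 * (mr / Q) + 1" using e(2) by simp
  then have H: "real (2 * h + e) \<le> 16 * (mr / Q)" using h(2) u1 u2 by simp
  \<comment> \<open>The halving in \<open>K\<close> turns 128 into 64, which is 4 (from the greedy
    choice) times 16 (from \<open>H\<close>).\<close>
  have "64 * mr \<le> real r * K"
  proof -
    have "128 * mr * lg \<le> real r * (real k)\<^sup>2" using dense by (simp add: mr_def lg_def k_def)
    then show ?thesis unfolding K_def using lg by (simp add: field_simps)
  qed
  also have "\<dots> \<le> real r * (real t * Q)" using tq by (intro mult_left_mono) (auto simp: Q_def)
  finally have "64 * (mr / Q) \<le> real r * real t" using Q1 by (simp add: field_simps)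
  then have "real (4 * (2 * h + e)) \<le> real (r * t)" using H by simp
  then have rt: "4 * (2 * h + e) \<le> r * t" by (simp only: of_nat_le_iff)
  have hcov: "2 * L \<le> g * int (h * q)"
  proof -
    have "2 * Lr = 2 * u * (G * Q)" using G1 Q1 by (simp add: u_def)
    also have "\<dots> \<le> real h * (G * Q)" using h(1) G1 Q1 by (intro mult_right_mono) auto
    also have "\<dots> = real_of_int (g * int (h * q))" by (simp add: G_def Q_def)
    finally have "real_of_int (2 * L) \<le> real_of_int (g * int (h * q))" by (simp add: Lr_def)
    then show ?thesis by (simp only: of_int_le_iff)
  qed
  have eL: "2 * m * g \<le> int e * L"
  proof -
    have "2 * mr * G \<le> real e * Lr" using e(1) L0 by (simp add: field_simps)
    then have "real_of_int (2 * m * g) \<le> real_of_int (int e * L)" by (simp add: mr_def G_def Lr_def)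
    then show ?thesis by (simp only: of_int_le_iff)
  qed
  \<comment> \<open>Starting at \<open>h * L\<close> ensures that no sum of \<open>h\<close>
    elements of \<open>Z\<close> exceeds a term, so the number of copies of \<open>L\<close> to add
    is nonnegative.\<close>
  define P where "P = {int h * L + i * g |i. i \<in> {1..2 * m}}"
  have vbound: "int h * L \<le> v \<and> v \<le> int h * L + 2 * m * g \<and> g dvd v" if "v \<in> P" for v
  proof -
    obtain i where i: "v = int h * L + i * g" "1 \<le> i" "i \<le> 2 * m" using \<open>v \<in> P\<close> by (auto simp: P_def)
    then show ?thesis using g gZ[OF LZ] by (auto intro: mult_right_mono)
  qed
  have "P \<subseteq> subset_sums A"
  proof
    fix v assume "v \<in> P"
    note v = vbound[OF this]
    obtain W where W: "set_mset W \<subseteq> Z" "size W \<le> h" "L dvd v - sum_mset W"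
      using cover[OF hcov] v by blast
    obtain c where c: "v - sum_mset W = L * c" using W(3) by (auto elim: dvdE)
    have "real_of_int (sum_mset W) \<le> real (size W) * real_of_int L"
      using W(1) ZL by (intro sum_mset_bounds(1)) auto
    then have "sum_mset W \<le> int (size W) * L" by (metis of_int_le_iff of_int_mult of_int_of_nat_eq)
    also have "\<dots> \<le> int h * L" using W(2) Lpos by (intro mult_right_mono) auto
    finally have "0 \<le> L * c" using v c by simp
    then have c0: "c \<ge> 0" using Lpos by (simp add: zero_le_mult_iff)
    have "sum_mset W \<ge> 0" using sum_mset_bounds(2)[of W 0] W(1) ZL by force
    then have "L * c \<le> L * (int h + int e)" using v c eL by (simp add: algebra_simps)
    then have ce: "c \<le> int h + int e" using Lpos by (simp add: mult_le_cancel_left_pos)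
    let ?W = "W + replicate_mset (nat c) L"
    have "set_mset ?W \<subseteq> Z" using W(1) LZ by (auto split: if_splits)
    moreover have "4 * size ?W \<le> r * t" using W(2) ce c0 rt by simp
    ultimately obtain U where "U \<subseteq># A" "sum_mset U = sum_mset ?W"
      using sums_of_popular_pairs[of Y r A Z t ?W] fin Y by (auto simp: Z_def f_def)
    moreover have "sum_mset ?W = v" using c c0 by (simp add: algebra_simps)
    ultimately show "v \<in> subset_sums A" by (auto simp: subset_sums_def)
  qed
  moreover have "is_arith_prog P (2 * m) g" unfolding is_arith_prog_def P_def by blast
  moreover have kQ: "x / Q \<le> 2 * x / real k" if "x \<ge> 0" for x
  proof -
    have "x * real k \<le> x * (2 * Q)" using q2 that by (intro mult_left_mono) (auto simp: Q_def)
    then show ?thesis using k Q1 by (simp add: field_simps)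
  qed
  have l0: "l \<ge> 0" using Ll L0 by simp
  have "real_of_int g \<le> 4 * l / real k" using Gl kQ[OF l0] by (simp add: G_def)
  moreover have "real_of_int (Max P) \<le> 32 * l * mr / real k"
  proof -
    have "P = (\<lambda>i. int h * L + i * g) ` {1..2 * m}" by (auto simp: P_def)
    then have "finite P" "P \<noteq> {}" using m by auto
    then have "Max P \<in> P" by (rule Max_in)
    from vbound[OF this] have "real_of_int (Max P) \<le> real_of_int (int h * L + 2 * m * g)"
      by (simp only: of_int_le_iff)
    also have "\<dots> = real h * Lr + 2 * mr * G" by (simp add: Lr_def mr_def G_def)
    also have "\<dots> \<le> (6 * (mr / Q)) * (2 * l) + 2 * mr * (2 * (l / Q))"
    proof (intro add_mono mult_mono)
      show "real h \<le> 6 * (mr / Q)" using h(2) u1 u2 by simp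
    qed (use Ll Gl L0 G1 m1 Q1 in auto)
    also have "\<dots> = 16 * ((l * mr) / Q)" by simp
    also have "\<dots> \<le> 16 * (2 * (l * mr) / real k)" using kQ[of "l * mr"] l0 m1 by simp
    finally show ?thesis by simp
  qed
  ultimately show ?thesis using that[of g P] g by (simp add: k_def mr_def)
qed

section \<open>Completeness modulo every small integer\<close>

text \<open>Let \<open>Y\<close> be a largest part of \<open>R\<close> with more residues of subset
  sums than elements. If residues are missing, \<open>Y\<close> has at most \<open>s - 2\<close>
  elements, and every element outside \<open>Y\<close> stabilises the residues of \<open>Y\<close>.
  The stabiliser is a proper subgroup, so a prime \<open>p\<close> dividing \<open>s\<close> divides
  everything outside \<open>Y\<close>, leaving too few elements not divisible by
  \<open>p\<close>.\<close>

lemma mod_complete_if_nondivisible: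
  assumes s: "s > 0"
    and R: "\<And>p. prime p \<Longrightarrow> p dvd s \<Longrightarrow> s - 1 \<le> int (size {#x \<in># R. \<not> p dvd x#})"
  shows "complete_mod s (subset_sums R)"
proof -
  define T where "T Y = (\<lambda>x. x mod s) ` subset_sums Y" for Y
  have T_sub: "T Y \<subseteq> {0..<s}" for Y using s by (auto simp: T_def)
  have T_fin: "finite (T Y)" for Y using finite_subset[OF T_sub] by simp
  have T_mono: "T Y \<subseteq> T Y'" if "Y \<subseteq># Y'" for Y Y'
    unfolding T_def subset_sums_def using that subset_mset.order_trans by blast
  have T0: "0 \<in> T Y" for Y
    unfolding T_def subset_sums_def by (intro image_eqI[of _ _ 0]) (auto intro!: exI[of _ "{#}"])
  let ?Q = "\<lambda>Y. Y \<subseteq># R \<and> size Y + 1 \<le> card (T Y)"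
  have "?Q {#}" using T0[of "{#}"] T_fin[of "{#}"] by (auto simp: Suc_le_eq card_gt_0_iff)
  moreover have "\<forall>Y. ?Q Y \<longrightarrow> size Y < Suc (size R)" by (simp add: size_mset_mono less_Suc_eq_le)
  ultimately have "\<exists>Y. ?Q Y \<and> (\<forall>V. ?Q V \<longrightarrow> size V \<le> size Y)"
    by (rule Lattices_Big.ex_has_greatest_nat)
  then obtain Y where Y: "?Q Y" and Ymax: "\<And>V. ?Q V \<Longrightarrow> size V \<le> size Y" by blast
  have "T Y = {0..<s}"
  proof (rule ccontr)
    assume nfull: "T Y \<noteq> {0..<s}"
    then have "card (T Y) < card {0..<s}" using T_sub by (intro psubset_card_mono) auto
    then have sizeY: "int (size Y) + 2 \<le> s" using Y s by auto
    \<comment> \<open>The stabiliser of \<open>T Y\<close>, lifted to a group of integers containing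
      \<open>s\<close>.\<close>
    define H where "H = {t. \<forall>u. u mod s \<in> T Y \<longleftrightarrow> (u + t) mod s \<in> T Y}"
    have "s \<in> H" by (simp add: H_def)
    have Hdiff: "x - y \<in> H" if "x \<in> H" "y \<in> H" for x y
    proof -
      have "u mod s \<in> T Y \<longleftrightarrow> (u + (x - y)) mod s \<in> T Y" for u
      proof -
        have "u mod s \<in> T Y \<longleftrightarrow> (u + x) mod s \<in> T Y" using \<open>x \<in> H\<close> by (simp add: H_def)
        moreover have "(u + (x - y)) mod s \<in> T Y \<longleftrightarrow> (u + (x - y) + y) mod s \<in> T Y"
          using \<open>y \<in> H\<close> unfolding H_def by blast
        ultimately show ?thesis by (simp add: algebra_simps)
      qed
      then show ?thesis unfolding H_def by blast
    qed
    obtain d where d: "d > 0" "H = {x. d dvd x}"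
      using int_subgroup_principal[OF \<open>s \<in> H\<close> s Hdiff] by blast
    have "d \<noteq> 1"
    proof
      assume "d = 1"
      have "u \<in> T Y" if "u \<in> {0..<s}" for u
      proof -
        have "u \<in> H" using d \<open>d = 1\<close> by simp
        then have "0 mod s \<in> T Y \<longleftrightarrow> (0 + u) mod s \<in> T Y" unfolding H_def by blast
        then show ?thesis using T0 that by simp
      qed
      then show False using nfull T_sub by blast
    qed
    then obtain p where p: "prime p" "p dvd d" using d(1) prime_divisor_exists[of d]
      by (auto simp: zmult_eq_1_iff)
    have pos: "p dvd s" using \<open>s \<in> H\<close> d p(2) by (auto intro: dvd_trans)
    have rest: "p dvd x" if x: "x \<in># R - Y" for x
    proof -
      have sub: "add_mset x Y \<subseteq># R"
        using x Y by (metis add_mset_add_single mset_subset_eq_single subset_mset.add_diff_inverse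
            subset_mset.add_left_mono)
      have "\<not> ?Q (add_mset x Y)" using Ymax[of "add_mset x Y"] by auto
      then have "card (T (add_mset x Y)) \<le> card (T Y)" using sub Y by auto
      then have eq: "T (add_mset x Y) = T Y"
        using T_mono[of Y "add_mset x Y"] T_fin card_seteq by (metis mset_subset_eq_add_right add_mset_add_single subset_mset.le_add_same_cancel1 empty_le)
      have shift: "(u + x) mod s \<in> T Y" if "u mod s \<in> T Y" for u
      proof -
        obtain V where V: "V \<subseteq># Y" "u mod s = sum_mset V mod s"
          using \<open>u mod s \<in> T Y\<close> by (auto simp: T_def subset_sums_def)
        have "(u + x) mod s = sum_mset (add_mset x V) mod s"
          using mod_add_cong[OF V(2), of x x] by (simp add: add.commute)
        moreover have "add_mset x V \<subseteq># add_mset x Y" using V(1) by simp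
        ultimately have "(u + x) mod s \<in> T (add_mset x Y)"
          unfolding T_def subset_sums_def by blast
        then show ?thesis using eq by simp
      qed
      \<comment> \<open>Translation by \<open>x\<close> maps the finite set \<open>T Y\<close>
        injectively into itself, hence onto it. This supplies the converse implication in
        \<open>H\<close>.\<close>
      define \<phi> where "\<phi> v = (v + x) mod s" for v
      have "inj_on \<phi> (T Y)"
      proof (rule inj_onI)
        fix a b assume ab: "a \<in> T Y" "b \<in> T Y" "\<phi> a = \<phi> b"
        then have "s dvd (a + x) - (b + x)" unfolding \<phi>_def by (simp only: mod_eq_dvd_iff)
        then have "a mod s = b mod s" by (simp add: mod_eq_dvd_iff)
        then show "a = b" using ab(1,2) T_sub[of Y] by (simp add: subset_iff)
      qed
      moreover have "\<phi> ` T Y \<subseteq> T Y"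
      proof (rule image_subsetI)
        fix v assume "v \<in> T Y"
        then have "v mod s \<in> T Y" using T_sub[of Y] by (simp add: subset_iff)
        then show "\<phi> v \<in> T Y" using shift[of v] by (simp add: \<phi>_def)
      qed
      ultimately have surj: "\<phi> ` T Y = T Y" by (intro endo_inj_surj T_fin)
      have "u mod s \<in> T Y" if "(u + x) mod s \<in> T Y" for u
      proof -
        have "(u + x) mod s \<in> \<phi> ` T Y" using surj that by simp
        then obtain v where v: "v \<in> T Y" "(u + x) mod s = (v + x) mod s" by (auto simp: \<phi>_def)
        then have "s dvd (u + x) - (v + x)" by (simp only: mod_eq_dvd_iff)
        then have "u mod s = v mod s" by (simp add: mod_eq_dvd_iff)
        then show ?thesis using v(1) T_sub[of Y] by (simp add: subset_iff)
      qed
      then have "x \<in> H" using shift unfolding H_def by blast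
      then show ?thesis using d p(2) by (auto intro: dvd_trans)
    qed
    have "{#x \<in># R. \<not> p dvd x#} = {#x \<in># Y. \<not> p dvd x#} + {#x \<in># R - Y. \<not> p dvd x#}"
      using Y by (metis filter_union_mset subset_mset.add_diff_inverse)
    moreover have "{#x \<in># R - Y. \<not> p dvd x#} = {#}" 
      unfolding filter_mset_eq_mempty_iff using rest by blast
    ultimately have "size {#x \<in># R. \<not> p dvd x#} \<le> size Y" by (simp add: size_filter_mset_lesseq)
    then show False using R[OF p(1) pos] sizeY by simp
  qed
  then have "T R = {0..<s}" using T_mono[of Y R] T_sub[of R] Y by auto
  then show ?thesis by (simp add: complete_mod_def T_def)
qed

section \<open>Small submultisets that no prime nearly divides\<close>

lemma exists_submultiset_size:
  assumes "n \<le> size X" obtains Y where "Y \<subseteq># X" "size Y = n"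
proof -
  obtain xs where xs: "mset xs = X" using ex_mset by blast
  have "mset (take n xs) \<subseteq># X" using xs by (metis append_take_drop_id mset_append mset_subset_eq_add_left)
  moreover have "size (mset (take n xs)) = n" using assms xs by auto
  ultimately show ?thesis using that by blast
qed

text \<open>The product of the distinct primes in \<open>B\<close> divides \<open>x\<close>, and
  each factor is at least 2.\<close>

lemma card_prime_divisors_le_log:
  fixes x :: int
  assumes "finite B" and B: "\<And>p. p \<in> B \<Longrightarrow> prime p \<and> p dvd x" and x: "x > 0"
  shows "real (card B) \<le> log 2 (real_of_int x)"
proof -
  have "\<Prod>B dvd x \<and> 2 ^ card B \<le> \<Prod>B" using assms(1) B
  proof (induction B)
    case (insert p B)
    have p: "prime p" "p dvd x" using insert.prems by auto
    have "coprime p (\<Prod>B)"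
      using insert by (intro prod_coprime_right) (auto intro!: primes_coprime)
    moreover have "2 * 2 ^ card B \<le> p * \<Prod>B"
      using insert prime_ge_2_int[OF p(1)] by (intro mult_mono) auto
    ultimately show ?case using insert p(2) by (auto intro!: divides_mult)
  qed simp
  then have "2 ^ card B \<le> x" using zdvd_imp_le[OF _ x] by force
  then have "(2::real) ^ card B \<le> real_of_int x" by (metis of_int_le_iff of_int_power of_int_numeral)
  then show ?thesis using x by (simp add: le_log_iff powr_realpow)
qed

text \<open>Counts the pairs of a prime and an element it divides: each element has at most
  \<open>log 2 m\<close> prime divisors.\<close>

lemma sum_size_divisible_le:
  fixes M :: "int multiset"
  assumes "finite B" and B: "\<And>p. p \<in> B \<Longrightarrow> prime p" and M: "\<And>x. x \<in># M \<Longrightarrow> 0 < x \<and> x \<le> m"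
  shows "real (\<Sum>p\<in>B. size {#x \<in># M. p dvd x#}) \<le> real (size M) * log 2 (real_of_int m)"
  using M
proof (induction M)
  case (add x M)
  have "(\<Sum>p\<in>B. size {#y \<in># add_mset x M. p dvd y#})
      = (\<Sum>p\<in>B. size {#y \<in># M. p dvd y#} + (if p dvd x then 1 else 0))"
    by (intro sum.cong) auto
  also have "\<dots> = (\<Sum>p\<in>B. size {#y \<in># M. p dvd y#}) + card {p \<in> B. p dvd x}"
    using assms(1) by (simp add: sum.distrib sum.If_cases Int_def)
  finally have eq: "(\<Sum>p\<in>B. size {#y \<in># add_mset x M. p dvd y#})
      = (\<Sum>p\<in>B. size {#y \<in># M. p dvd y#}) + card {p \<in> B. p dvd x}" .
  have x: "0 < x" "x \<le> m" using add.prems by auto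
  have "real (card {p \<in> B. p dvd x}) \<le> log 2 (real_of_int x)"
    using assms(1) B x by (intro card_prime_divisors_le_log) auto
  also have "\<dots> \<le> log 2 (real_of_int m)" using x by simp
  finally have "real (card {p \<in> B. p dvd x}) \<le> log 2 (real_of_int m)" .
  moreover have "real (\<Sum>p\<in>B. size {#y \<in># M. p dvd y#}) \<le> real (size M) * log 2 (real_of_int m)"
    using add by auto
  ultimately show ?case unfolding eq by (simp add: algebra_simps)
qed simp

text \<open>Among any \<^term>\<open>2 * D\<close> elements, only about \<^term>\<open>2 * log 2 m\<close> primes divide more than half;
  it suffices to repair those one at a time.\<close>

lemma small_submultiset_many_nondivisible:
  fixes X :: "int multiset"
  assumes X: "\<And>x. x \<in># X \<Longrightarrow> 0 < x \<and> x \<le> m" and size: "2 * D \<le> size X"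
    and nd: "\<And>p. prime p \<Longrightarrow> D \<le> size {#x \<in># X. \<not> p dvd x#}"
  obtains R where "R \<subseteq># X" "real (size R) \<le> 2 * real D * (1 + log 2 (real_of_int m))"
    "\<And>p. prime p \<Longrightarrow> D \<le> size {#x \<in># R. \<not> p dvd x#}"
proof (cases "D = 0")
  case True
  then show ?thesis using that[of "{#}"] by simp
next
  case False
  obtain R0 where R0: "R0 \<subseteq># X" "size R0 = 2 * D" using exists_submultiset_size[OF size] .
  have split: "size {#x \<in># R0. p dvd x#} + size {#x \<in># R0. \<not> p dvd x#} = 2 * D" for p
    using R0(2) multiset_partition[of R0 "\<lambda>x. p dvd x"] by (metis size_union)
  define Bad where "Bad = {p::int. prime p \<and> size {#x \<in># R0. \<not> p dvd x#} < D}"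
  have R0X: "0 < x \<and> x \<le> m" if "x \<in># R0" for x using X[OF mset_subset_eqD[OF R0(1) that]] .
  \<comment> \<open>Only for finiteness: a bad prime divides some element of
    \<open>R0\<close>.\<close>
  have "Bad \<subseteq> {0..m}"
  proof
    fix p assume "p \<in> Bad"
    then have p: "prime p" "size {#x \<in># R0. \<not> p dvd x#} < D" by (auto simp: Bad_def)
    then have "size {#x \<in># R0. p dvd x#} > 0" using split[of p] by linarith
    then have "{#x \<in># R0. p dvd x#} \<noteq> {#}" by (simp only: nonempty_has_size)
    then obtain x where "x \<in># R0" "p dvd x" unfolding filter_mset_eq_mempty_iff by blast
    then show "p \<in> {0..m}" using R0X[of x] zdvd_imp_le[of p x] prime_gt_0_int[OF p(1)] by auto
  qed
  then have fin: "finite Bad" using finite_subset by blast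
  \<comment> \<open>A bad prime divides more than \<open>D\<close> of the \<open>2 * D\<close>
    elements of \<open>R0\<close>, so counting divisible pairs limits \<open>Bad\<close> to about
    \<open>2 * log 2 m\<close> primes.\<close>
  have "D * card Bad = (\<Sum>p\<in>Bad. D)" by simp
  also have "\<dots> \<le> (\<Sum>p\<in>Bad. size {#x \<in># R0. p dvd x#})"
  proof (rule sum_mono)
    fix p assume "p \<in> Bad"
    then show "D \<le> size {#x \<in># R0. p dvd x#}" using split[of p] by (auto simp: Bad_def)
  qed
  finally have "real (D * card Bad) \<le> real (\<Sum>p\<in>Bad. size {#x \<in># R0. p dvd x#})"
    by (simp only: of_nat_le_iff)
  also have "\<dots> \<le> real (size R0) * log 2 (real_of_int m)"
    using fin R0X by (intro sum_size_divisible_le) (auto simp: Bad_def)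
  finally have cardBad: "real (D * card Bad) \<le> 2 * real D * log 2 (real_of_int m)" using R0(2) by simp
  have "\<exists>R. R0 \<subseteq># R \<and> R \<subseteq># X \<and> size R \<le> 2 * D + D * card C \<and>
      (\<forall>p\<in>C. D \<le> size {#x \<in># R. \<not> p dvd x#})" if "C \<subseteq> Bad" for C
    using finite_subset[OF that fin] that
  proof (induction C)
    case empty
    then show ?case using R0 by (intro exI[of _ R0]) auto
  next
    case (insert p C)
    then obtain R where R: "R0 \<subseteq># R" "R \<subseteq># X" "size R \<le> 2 * D + D * card C"
      "\<forall>p\<in>C. D \<le> size {#x \<in># R. \<not> p dvd x#}" by auto
    have "D \<le> size {#x \<in># X. \<not> p dvd x#}" using insert.prems nd by (auto simp: Bad_def)
    then obtain Q where Q: "Q \<subseteq># {#x \<in># X. \<not> p dvd x#}" "size Q = D"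
      by (rule exists_submultiset_size)
    have QX: "Q \<subseteq># X" using Q(1) multiset_filter_subset subset_mset.order_trans by blast
    \<comment> \<open>The union takes maxima of multiplicities and so stays inside \<open>X\<close>,
      where \<open>R + Q\<close> might not; its size still grows by at most
      \<open>D\<close>.\<close>
    have RQ: "R \<subseteq># R \<union># Q" "Q \<subseteq># R \<union># Q" "R \<union># Q \<subseteq># X" using R(2) QX by auto
    have "Q = {#x \<in># Q. \<not> p dvd x#}"
      using mset_subset_eqD[OF Q(1)] by (intro filter_mset_cong0[of Q "\<lambda>_. True", simplified]) auto
    then have "D \<le> size {#x \<in># R \<union># Q. \<not> p dvd x#}"
      using size_mset_mono[OF multiset_filter_mono[OF RQ(2), of "\<lambda>x. \<not> p dvd x"]] Q(2) by simp
    moreover have "D \<le> size {#x \<in># R \<union># Q. \<not> p' dvd x#}" if "p' \<in> C" for p'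
      using size_mset_mono[OF multiset_filter_mono[OF RQ(1), of "\<lambda>x. \<not> p' dvd x"]] R(4) that by force
    moreover have "R \<union># Q \<subseteq># R + Q" by (simp add: subseteq_mset_def)
    then have "size (R \<union># Q) \<le> 2 * D + D * card (insert p C)"
      using size_mset_mono[of "R \<union># Q" "R + Q"] R(3) Q(2) insert.hyps by simp
    ultimately show ?case using RQ R(1) by (intro exI[of _ "R \<union># Q"]) (auto intro: subset_mset.order_trans)
  qed
  from this[of Bad] obtain R where R: "R0 \<subseteq># R" "R \<subseteq># X" "size R \<le> 2 * D + D * card Bad"
      "\<forall>p\<in>Bad. D \<le> size {#x \<in># R. \<not> p dvd x#}" by auto
  show ?thesis
  proof (rule that[OF R(2)])
    have "real (size R) \<le> real (2 * D + D * card Bad)" using R(3) by (simp only: of_nat_le_iff)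
    also have "\<dots> = 2 * real D + real (D * card Bad)" by simp
    finally show "real (size R) \<le> 2 * real D * (1 + log 2 (real_of_int m))"
      using cardBad by (simp add: algebra_simps)
    show "D \<le> size {#x \<in># R. \<not> p dvd x#}" if "prime p" for p
    proof (cases "p \<in> Bad")
      case False
      then have "D \<le> size {#x \<in># R0. \<not> p dvd x#}" using that by (simp add: Bad_def)
      then show ?thesis
        using size_mset_mono[OF multiset_filter_mono[OF R(1), of "\<lambda>x. \<not> p dvd x"]] by simp
    qed (use R(4) in auto)
  qed
qed

section \<open>The decomposition\<close>

theorem theorem4p26:
  fixes X :: "int multiset" and n :: nat and \<delta> \<alpha> :: real
  assumes "X \<noteq> {#}"
    and "pos_mset X"
    and "n = size X"
    and "\<delta> = 1699200 * log 2 (2 * real n) * (log 2 (2 * real (max_mult X)))\<^sup>2"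
    and "\<alpha> = 42480 * log 2 (2 * real (max_mult X))"
    and "delta_dense \<delta> X"
    and "\<not> (\<exists>d. almost_divisor \<alpha> X d)"
  shows "\<exists>R A G :: int multiset. \<exists>s :: int.
      X = R + A + G \<and>
      0 < s \<and>
      real_of_int s \<le> 42480 * real (max_mult X) * real_of_int (sum_mset X)
                        * log 2 (2 * real (max_mult X)) / (real n)\<^sup>2 \<and>
      complete_mod s (subset_sums R) \<and>
      (\<exists>P. is_arith_prog P (2 * Max_mset X) s \<and> P \<subseteq> subset_sums A \<and>
           real_of_int (Max P) \<le> 84960 * real (max_mult X) * real_of_int (Max_mset X)
                        * real_of_int (sum_mset X) * log 2 (2 * real (max_mult X)) / (real n)\<^sup>2) \<and>
      real_of_int (sum_mset G) \<ge> real_of_int (sum_mset X) / 2"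
proof -
  define \<mu> where "\<mu> = max_mult X"
  define m where "m = Max_mset X"
  define sig where "sig = real_of_int (sum_mset X)"
  define M where "M = log 2 (2 * real \<mu>)"
  define N where "N = log 2 (2 * real n)"
  define mr where "mr = real_of_int m"
  define nr where "nr = real n"
  define Lam where "Lam = real \<mu> * sig * M / nr\<^sup>2"
  have Xm: "0 < x \<and> x \<le> m" if "x \<in># X" for x
    using that assms(2) by (auto simp: pos_mset_def m_def)
  have count_le: "count X x \<le> \<mu>" for x
  proof (cases "x \<in># X")
    case True
    then show ?thesis unfolding \<mu>_def max_mult_def by (intro Max_ge) auto
  qed (simp add: not_in_iff)
  obtain x0 where x0: "x0 \<in># X" using assms(1) by auto
  have mu1: "\<mu> \<ge> 1" using count_le[of x0] x0 by (metis Suc_leI One_nat_def count_greater_zero_iff order.trans)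
  have m1: "mr \<ge> 1" using Xm[OF x0] by (simp add: mr_def)
  have n1: "n \<ge> 1" using x0 assms(3) by (metis Suc_leI One_nat_def assms(1) nonempty_has_size)
  have M1: "M \<ge> 1" using mu1 by (simp add: M_def le_log_iff)
  have N1: "N \<ge> 1" using n1 by (simp add: N_def le_log_iff)
  have dense: "1699200 * N * M\<^sup>2 * real \<mu> * mr \<le> nr\<^sup>2"
    using assms(3,4,6) by (simp add: delta_dense_def N_def M_def \<mu>_def mr_def m_def nr_def)
  have mM: "real \<mu> * mr \<le> real \<mu> * mr * (N * M\<^sup>2)"
  proof -
    have "1 \<le> N * M\<^sup>2" using N1 M1 mult_mono[of 1 N 1 "M\<^sup>2"] by simp
    then show ?thesis
      using mult_left_mono[of 1 "N * M\<^sup>2" "real \<mu> * mr"] m1 by simp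
  qed
  have mum: "mr \<le> real \<mu> * mr" using mu1 m1 by simp
  have n2: "1699200 * mr \<le> nr\<^sup>2" using dense mM mum by (simp add: mult_ac)
  have n1000: "nr \<ge> 1000"
  proof (rule ccontr)
    assume "\<not> nr \<ge> 1000"
    then have "nr\<^sup>2 \<le> 1000\<^sup>2" by (intro power_mono) (auto simp: nr_def)
    then show False using n2 m1 by simp
  qed
  have sig0: "sig \<ge> 0" unfolding sig_def using sum_mset_bounds(2)[of X 0] Xm by fastforce
  have sig_nm: "sig \<le> nr * mr" unfolding sig_def nr_def mr_def assms(3)
    using Xm by (intro sum_mset_bounds(1)) auto
  have Lam0: "Lam \<ge> 0" using sig0 M1 by (simp add: Lam_def)
  \<comment> \<open>Density multiplied by \<open>sig\<close>, with one factor \<open>M\<close> given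
    up. \<open>E1\<close> limits the sum of \<open>R\<close>, and \<open>E2\<close> its
    size.\<close>
  have E1: "1699200 * N * (mr * Lam) \<le> sig"
  proof -
    have "M * 1 \<le> M * M" using M1 by (intro mult_left_mono) auto
    then have "1699200 * N * M * real \<mu> * mr \<le> 1699200 * N * M\<^sup>2 * real \<mu> * mr"
      using N1 m1 by (intro mult_right_mono mult_left_mono) (auto simp: power2_eq_square)
    then have "1699200 * N * M * real \<mu> * mr \<le> nr\<^sup>2" using dense by simp
    then have "sig * (1699200 * N * M * real \<mu> * mr) \<le> sig * nr\<^sup>2" using sig0 by (intro mult_left_mono)
    then show ?thesis using n1000 by (simp add: Lam_def field_simps)
  qed
  have E2: "1699200 * N * Lam \<le> nr"
  proof -
    have "(1699200 * N * Lam) * mr \<le> nr * mr" using E1 sig_nm by (simp add: mult_ac)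
    then show ?thesis using m1 by simp
  qed
  \<comment> \<open>Density gives \<open>m \<le> n * n\<close>, so the number of bad primes is
    controlled by \<open>N\<close>.\<close>
  have logm: "1 + log 2 mr \<le> 2 * N"
  proof -
    have "mr \<le> nr\<^sup>2" using n2 m1 by linarith
    then have "log 2 mr \<le> log 2 (nr\<^sup>2)" using m1 by (intro log_mono) auto
    also have "\<dots> = 2 * log 2 nr" using n1000 by (simp add: log_nat_power)
    finally show ?thesis unfolding N_def nr_def[symmetric] using n1000 by (simp add: log_mult)
  qed

  \<comment> \<open>The step found below satisfies \<open>s \<le> 64 * Lam\<close>, hence
    \<open>s \<le> D\<close>. The absence of almost divisors leaves far more than \<open>D\<close>
    elements not divisible by any given prime.\<close>
  define D where "D = nat \<lfloor>64 * Lam\<rfloor>"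
  have D: "real D \<le> 64 * Lam" using Lam0 by (simp add: D_def)
  have nd: "D \<le> size {#x \<in># X. \<not> p dvd x#}" if "prime p" for p
  proof -
    have "\<not> almost_divisor \<alpha> X p" using assms(7) by blast
    then have "\<alpha> * real \<mu> * sig / nr\<^sup>2 < real (size (nondivisible_part X p))"
      using prime_gt_1_int[OF that] by (simp add: almost_divisor_def assms(3) \<mu>_def sig_def nr_def)
    moreover have "\<alpha> * real \<mu> * sig / nr\<^sup>2 = 42480 * Lam"
      by (simp add: assms(5) Lam_def M_def \<mu>_def)
    moreover have "nondivisible_part X p = {#x \<in># X. \<not> p dvd x#}"
      unfolding nondivisible_part_def divisible_part_def
      by (metis add_diff_cancel_left' multiset_partition)
    ultimately show ?thesis using D Lam0 by simp
  qed
  have LN: "Lam \<le> N * Lam" using N1 Lam0 by (simp add: mult_right_mono[of 1 N Lam, simplified])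
  have "2 * D \<le> size X" using D E2 LN Lam0 assms(3) unfolding nr_def by linarith
  then obtain R where R: "R \<subseteq># X" "real (size R) \<le> 2 * real D * (1 + log 2 (real_of_int m))"
    "\<And>p. prime p \<Longrightarrow> D \<le> size {#x \<in># R. \<not> p dvd x#}"
    using small_submultiset_many_nondivisible[OF Xm _ nd] by blast
  have "real (size R) \<le> 2 * (64 * Lam) * (2 * N)"
  proof -
    have "2 * real D * (1 + log 2 mr) \<le> 2 * (64 * Lam) * (2 * N)"
      using D logm Lam0 m1 by (intro mult_mono) auto
    then show ?thesis using R(2) by (simp add: mr_def)
  qed
  then have sizeR: "real (size R) \<le> 256 * (N * Lam)" by (simp add: mult_ac)
  have R_small: "real (size R) \<le> nr / 1000" using sizeR E2 by simp
  have "real_of_int (sum_mset R) \<le> real (size R) * mr" unfolding mr_def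
    using mset_subset_eqD[OF R(1)] Xm by (intro sum_mset_bounds(1)) auto
  also have "\<dots> \<le> (256 * (N * Lam)) * mr" using sizeR m1 by (intro mult_right_mono) auto
  also have "\<dots> \<le> sig / 1000" using E1 sig0 by (simp add: mult_ac)
  finally have sumR: "real_of_int (sum_mset R) \<le> sig / 1000" .

  define l where "l = 2 * sig / nr"
  have sig_pos: "sig > 0"
  proof -
    have "nr * 1 \<le> sig" unfolding sig_def nr_def assms(3)
      using Xm by (intro sum_mset_bounds(2)) force
    then show ?thesis using n1000 by simp
  qed
  have l0: "l > 0" using sig_pos n1000 by (simp add: l_def)
  \<comment> \<open>Markov's inequality: \<open>l\<close> is twice the average, so at most half of
    the elements exceed it.\<close>
  define Big where "Big = {#x \<in># X. \<not> real_of_int x \<le> l#}"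
  have "real (size Big) * l \<le> sig"
  proof -
    have "real (size Big) * l \<le> real_of_int (sum_mset Big)"
      by (intro sum_mset_bounds(2)) (auto simp: Big_def)
    moreover have "0 \<le> real_of_int (sum_mset {#x \<in># X. real_of_int x \<le> l#})"
      using sum_mset_bounds(2)[of "{#x \<in># X. real_of_int x \<le> l#}" 0] Xm by fastforce
    moreover have "sum_mset X = sum_mset {#x \<in># X. real_of_int x \<le> l#} + sum_mset Big"
      unfolding Big_def by (metis multiset_partition sum_mset.union)
    ultimately show ?thesis by (simp add: sig_def)
  qed
  then have Big: "real (size Big) \<le> nr / 2"
    using sig_pos n1000 by (simp add: l_def field_simps)
  define B0 where "B0 = {#x \<in># X - R. real_of_int x \<le> l#}"
  have "size (X - R) = size B0 + size {#x \<in># X - R. \<not> real_of_int x \<le> l#}"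
    unfolding B0_def by (metis multiset_partition size_union)
  moreover have "size {#x \<in># X - R. \<not> real_of_int x \<le> l#} \<le> size Big"
    unfolding Big_def by (intro size_mset_mono multiset_filter_mono) simp
  moreover have "size (X - R) = size X - size R" "size R \<le> size X"
    using R(1) by (simp_all add: size_Diff_submset size_mset_mono)
  ultimately have "nr \<le> real (size R) + real (size B0) + real (size Big)"
    unfolding nr_def assms(3) by linarith
  then have B0_size: "real (size B0) \<ge> nr / 5" using R_small Big by simp
  \<comment> \<open>Large enough for the first pigeonhole, yet at most \<open>n / 5\<close>, so that
    \<open>b\<close> elements of size at most \<open>l\<close> sum to at most
    \<open>2 * sig / 5\<close>.\<close>
  define b where "b = n div 8 + 1"
  have b: "nr / 8 \<le> real b" "real b \<le> nr / 5" using n1000 unfolding b_def nr_def by linarith+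
  have "b \<le> size B0" using b(2) B0_size by linarith
  then obtain B where B: "B \<subseteq># B0" "size B = b" by (rule exists_submultiset_size)
  have BXR: "B \<subseteq># X - R"
    using B(1) multiset_filter_subset subset_mset.order_trans unfolding B0_def by blast
  have Bl: "real_of_int x \<le> l" and BX: "x \<in># X" if "x \<in># B" for x
    using mset_subset_eqD[OF B(1) that] by (auto simp: B0_def dest: in_diffD)
  have sumB: "real_of_int (sum_mset B) \<le> 2 * sig / 5"
  proof -
    have "real_of_int (sum_mset B) \<le> real (size B) * l" using Bl by (intro sum_mset_bounds(1))
    also have "\<dots> \<le> nr / 5 * l" using b(2) B(2) l0 by (intro mult_right_mono) auto
    also have "\<dots> = 2 * sig / 5" using n1000 by (simp add: l_def)
    finally show ?thesis .
  qed

  have countB: "count B x \<le> \<mu>" for x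
    using count_le[of x] mset_subset_eq_count[OF BXR, of x] by simp
  \<comment> \<open>Pigeonhole over multiplicities, costing the factor \<open>M\<close>.\<close>
  obtain r where r: "1 \<le> r" "r \<le> \<mu>"
    "real b / M \<le> real r * real (card {y \<in> set_mset B. r \<le> count B y})"
  proof (rule popular_level[of "set_mset B" "count B" \<mu> 0 "real b / M"])
    show "real b / M > 0" using M1 by (simp add: b_def)
    show "0 * real \<mu> + real b / M * log 2 (2 * real \<mu>) \<le> real (sum (count B) (set_mset B))"
      using M1 B(2) by (simp add: M_def[symmetric] size_multiset_overloaded_eq)
  qed (use countB mu1 in auto)
  define Y where "Y = {y \<in> set_mset B. r \<le> count B y}"
  define k where "k = real (card Y)"
  have rk: "nr \<le> 8 * M * (real r * k)"
  proof -
    have "real b \<le> M * (real r * k)" using r(3) M1 by (simp add: Y_def k_def field_simps)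
    then show ?thesis using b(1) by simp
  qed
  have kpos: "k > 0" using rk n1000 by (cases "k = 0") (auto simp: k_def)
  then have Yne: "Y \<noteq> {}" by (auto simp: k_def)
  have k1: "k \<ge> 1" using kpos by (simp add: k_def Suc_le_eq)
  have kn: "k \<le> nr"
  proof -
    have "card Y \<le> card (set_mset B)" unfolding Y_def by (intro card_mono) auto
    also have "\<dots> \<le> size B" by (simp add: size_multiset_overloaded_eq card_eq_sum sum_mono Suc_le_eq del: sum_constant)
    finally have "real (card Y) \<le> real (size B)" by simp
    then show ?thesis using b(2) B(2) n1000 by (simp add: k_def)
  qed
  have rpos: "real r > 0" using r(1) by simp
  \<comment> \<open>Squaring \<open>rk\<close> loses \<open>64 * M\<^sup>2\<close>, which explains
    the squared logarithm in \<open>\<delta>\<close>; one factor \<open>r\<close> is absorbed by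
    \<open>r \<le> \<mu>\<close>. The surplus 1699200 / 64 = 26550 exceeds 128.\<close>
  have kdense: "128 * mr * log 2 (2 * k) \<le> real r * k\<^sup>2"
  proof -
    have "nr\<^sup>2 \<le> (8 * M * (real r * k))\<^sup>2" using rk n1000 by (intro power_mono) auto
    also have "\<dots> = M\<^sup>2 * (64 * real r * (real r * k\<^sup>2))" by (simp add: power2_eq_square)
    finally have "1699200 * N * M\<^sup>2 * real \<mu> * mr \<le> M\<^sup>2 * (64 * real r * (real r * k\<^sup>2))"
      using dense by (rule order.trans[rotated])
    then have "M\<^sup>2 * (1699200 * N * real \<mu> * mr) \<le> M\<^sup>2 * (64 * real r * (real r * k\<^sup>2))"
      by (simp add: mult_ac)
    then have "1699200 * N * real \<mu> * mr \<le> 64 * real r * (real r * k\<^sup>2)"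
      using M1 by (simp add: mult_le_cancel_left_pos)
    moreover have "1699200 * N * real r * mr \<le> 1699200 * N * real \<mu> * mr"
      using r(2) N1 m1 by (intro mult_right_mono mult_left_mono) auto
    ultimately have "real r * (1699200 * N * mr) \<le> real r * (64 * (real r * k\<^sup>2))" by (simp add: mult_ac)
    then have "1699200 * N * mr \<le> 64 * (real r * k\<^sup>2)" using rpos by (simp only: mult_le_cancel_left_pos)
    moreover have "log 2 (2 * k) \<le> N" unfolding N_def nr_def[symmetric] using k1 kn by simp
    then have "mr * log 2 (2 * k) \<le> mr * N" using m1 by (intro mult_left_mono) auto
    moreover have "0 \<le> N * mr" using N1 m1 by simp
    ultimately show ?thesis by (simp add: mult_ac)
  qed
  have finY: "finite Y" by (simp add: Y_def)
  have Yprop: "0 < y \<and> y \<le> m \<and> real_of_int y \<le> l \<and> r \<le> count B y" if "y \<in> Y" for y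
    using that Xm[OF BX, of y] Bl[of y] by (simp add: Y_def)
  obtain s P where sP: "0 < s" "real_of_int s \<le> 4 * l / k" "is_arith_prog P (2 * m) s"
    "P \<subseteq> subset_sums B" "real_of_int (Max P) \<le> 32 * l * mr / k"
    using arith_prog_in_subset_sums[OF finY Yne Yprop kdense[unfolded k_def mr_def]]
    unfolding k_def mr_def by metis
  \<comment> \<open>From \<open>r \<le> \<mu>\<close> and \<open>rk\<close>, \<open>1 / k\<close> is
    at most \<open>8 * M * \<mu> / n\<close>, while \<open>l = 2 * sig / n\<close>. With
    \<open>s \<le> 4 * l / k\<close> this is the origin of the 64 in \<open>D\<close>.\<close>
  have lk: "l / k \<le> 16 * Lam"
  proof -
    have "real r * k \<le> real \<mu> * k" using r(2) k1 by (intro mult_right_mono) auto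
    then have "8 * M * (real r * k) \<le> 8 * M * (real \<mu> * k)" using M1 by (intro mult_left_mono) auto
    then have "nr \<le> 8 * M * (real \<mu> * k)" using rk by simp
    then have "2 * sig * nr \<le> 2 * sig * (8 * M * (real \<mu> * k))" using sig0 by (intro mult_left_mono) auto
    then have "2 * sig * nr / (nr\<^sup>2 * k) \<le> 2 * sig * (8 * M * (real \<mu> * k)) / (nr\<^sup>2 * k)"
      using kpos by (intro divide_right_mono) auto
    then show ?thesis using kpos n1000 by (simp add: l_def Lam_def power2_eq_square mult_ac)
  qed
  have s64: "real_of_int s \<le> 64 * Lam" using sP(2) lk by simp
  have "complete_mod s (subset_sums R)"
  proof (rule mod_complete_if_nondivisible[OF sP(1)])
    fix p :: int assume "prime p"
    have "s \<le> int D" using s64 Lam0 unfolding D_def by linarith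
    then show "s - 1 \<le> int (size {#x \<in># R. \<not> p dvd x#})" using R(3)[OF \<open>prime p\<close>] by linarith
  qed
  moreover have "real_of_int (Max P) \<le> 84960 * (mr * Lam)"
  proof -
    have "mr * (l / k) \<le> mr * (16 * Lam)" using lk m1 by (intro mult_left_mono) auto
    moreover have "0 \<le> mr * Lam" using m1 Lam0 by simp
    moreover have "32 * l * mr / k = 32 * (mr * (l / k))" by simp
    ultimately show ?thesis using sP(5) by linarith
  qed
  then have "real_of_int (Max P) \<le> 84960 * real (max_mult X) * real_of_int (Max_mset X)
      * real_of_int (sum_mset X) * log 2 (2 * real (max_mult X)) / (real n)\<^sup>2"
    by (simp add: Lam_def M_def \<mu>_def mr_def m_def sig_def nr_def mult_ac)
  moreover have "real_of_int s \<le> 42480 * Lam" using s64 Lam0 by simp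
  then have "real_of_int s \<le> 42480 * real (max_mult X) * real_of_int (sum_mset X)
      * log 2 (2 * real (max_mult X)) / (real n)\<^sup>2"
    by (simp add: Lam_def M_def \<mu>_def sig_def nr_def mult_ac)
  \<comment> \<open>\<open>B\<close> plays the part of \<open>A\<close>. Removing \<open>R\<close>
    and \<open>B\<close> costs at most \<open>sig / 1000 + 2 * sig / 5\<close>, less than half of
    the sum.\<close>
  moreover define G where "G = X - R - B"
  have XG: "X = R + B + G" unfolding G_def
    using R(1) BXR by (metis add.assoc subset_mset.add_diff_inverse)
  moreover have "sum_mset X = sum_mset R + sum_mset B + sum_mset G" by (subst XG) simp
  then have "real_of_int (sum_mset X) / 2 \<le> real_of_int (sum_mset G)"
    using sumR sumB sig0 unfolding sig_def by simp
  ultimately show ?thesis using sP unfolding m_def by blast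
qed

end
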